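(* Let $X$ be an elliptic curve, $\alpha\in H^0(X,\Omega^1_X)$ a nowhere-vanishing holomorphic one-form, and $E=\mathcal O_X^{\oplus2}$ with its fixed trivial Dolbeault operator $\bar\partial$. On a real interval $U$ about $0$, consider $$\theta_t=\begin{pmatrix}0&t\\0&t^2\end{pmatrix}\alpha .$$ Every fibre $(E,\bar\partial+\theta_t)$ is polystable, but no choice of fibrewise harmonic metrics extends continuously through $t=0$. Nevertheless the family admits a smooth relative harmonic filtration and hence belongs to $\mathscr M^{\mathcal H}_{\mathrm{Dol},d}(X)$ for every $d\in\{0,1,2,\ldots,\infty\}$.
   Context: A Hermitian metric $h$ on a Higgs bundle $(E,\bar\partial_E+\theta)$ is harmonic if $\nabla_h=\bar\partial_E+\theta+\partial_{E,h}+\theta^{\dagger_h}$ is flat, where $\partial_{E,h}$ is the $(1,0)$-part of the Chern connection and $\theta^{\dagger_h}$ the $h$-adjoint. Continuity of a family of metrics is continuity in the parameter; "no choice extends continuously through $t=0$" means there is no family $(h_t)_{t\in U}$ of harmonic metrics on the fibres that is continuous in $t$ at $0$. Mixed regularity $C^d_UC^\infty_X$: locally on $U$ the bundle family over $U\times X$ is identified with the pullback of a fixed bundle on $X$ so that all transition, operator, metric and subbundle coefficients are smooth in $x\in X$ and $C^d$ in $u$ with values in $C^\infty(X)$; Higgs operators act in the $X$-direction only and are integrable on each slice. A $C^d$ relative harmonic filtration of a $C^d_UC^\infty_X$ Higgs family $(E,\mathcal D'')$ is a finite filtration $0=F_0\subset F_1\subset\cdots\subset F_\ell=E$ by $\mathcal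 D''$-invariant $C^d_UC^\infty_X$ subbundles such that every quotient $F_i/F_{i-1}$ admits a (slicewise) harmonic metric of class $C^d_UC^\infty_X$. A smooth relative harmonic filtration is the case $d=\infty$. $\mathscr M^{\mathcal H}_{\mathrm{Dol},d}(X)$ is the stackification, on the site of $C^d$ manifolds with open covers, of the prestack generated from $C^d_UC^\infty_X$ Higgs families admitting $C^d_UC^\infty_X$ harmonic metrics by finite iterated extensions (short exact sequences of $C^d_UC^\infty_X$ Higgs families). *)

theory Defs
  imports
    "HOL-Analysis.Analysis"
    "HOL-Library.Extended_Nat"
    "Jordan_Normal_Form.Schur_Decomposition"
begin


text \<open>
  The elliptic curve is X = C/L for a lattice L.  Subsets of X are L-invariant subsets of the
  complex plane, functions on them are L-periodic functions, and dz, dz-bar frame the cotangent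
  bundle, so that forms are given by their coefficients.
\<close>

definition is_lattice_basis :: "complex set \<Rightarrow> complex \<Rightarrow> complex \<Rightarrow> bool" where
  "is_lattice_basis L w1 w2 \<longleftrightarrow>
     Im (w1 * cnj w2) \<noteq> 0 \<and> L = {of_int m * w1 + of_int n * w2 | m n. True}"

definition is_lattice :: "complex set \<Rightarrow> bool" where
  "is_lattice L \<longleftrightarrow> (\<exists>w1 w2. is_lattice_basis L w1 w2)"

definition period_parallelogram :: "complex \<Rightarrow> complex \<Rightarrow> complex set" where
  "period_parallelogram w1 w2 =
     {of_real s * w1 + of_real t * w2 | s t. s \<in> {0..1} \<and> t \<in> {0..1}}"

definition periodic_on :: "complex set \<Rightarrow> complex set \<Rightarrow> (complex \<Rightarrow> 'a) \<Rightarrow> bool" where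
  "periodic_on L W f \<longleftrightarrow> (\<forall>z\<in>W. \<forall>l\<in>L. f (z + l) = f z)"

definition torus_open :: "complex set \<Rightarrow> complex set \<Rightarrow> bool" where
  "torus_open L W \<longleftrightarrow> open W \<and> (\<forall>z\<in>W. \<forall>l\<in>L. z + l \<in> W)"


section \<open>Smooth functions and mixed regularity\<close>

definition dir_deriv :: "complex \<Rightarrow> (complex \<Rightarrow> complex) \<Rightarrow> complex \<Rightarrow> complex" where
  "dir_deriv v f z = frechet_derivative f (at z) v"

definition iter_deriv :: "complex list \<Rightarrow> (complex \<Rightarrow> complex) \<Rightarrow> complex \<Rightarrow> complex" where
  "iter_deriv vs f = foldr dir_deriv vs f"

definition d_z :: "(complex \<Rightarrow> complex) \<Rightarrow> complex \<Rightarrow> complex" where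
  "d_z f z = (dir_deriv 1 f z - \<i> * dir_deriv \<i> f z) / 2"

definition d_zbar :: "(complex \<Rightarrow> complex) \<Rightarrow> complex \<Rightarrow> complex" where
  "d_zbar f z = (dir_deriv 1 f z + \<i> * dir_deriv \<i> f z) / 2"

definition Cinf_on :: "complex set \<Rightarrow> (complex \<Rightarrow> complex) \<Rightarrow> bool" where
  "Cinf_on W f \<longleftrightarrow> (\<forall>vs. iter_deriv vs f differentiable_on W)"

text \<open>Convergence in the Frechet space of smooth functions on the open set W.\<close>

definition Cinf_tendsto ::
  "complex set \<Rightarrow> ('a \<Rightarrow> complex \<Rightarrow> complex) \<Rightarrow> (complex \<Rightarrow> complex) \<Rightarrow> 'a filter \<Rightarrow> bool" where
  "Cinf_tendsto W f g F \<longleftrightarrow>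
     (\<forall>vs K. compact K \<and> K \<subseteq> W \<longrightarrow> uniform_limit K (\<lambda>u. iter_deriv vs (f u)) (iter_deriv vs g) F)"

text \<open>
  f is of class C^d on the open set V with values in the smooth functions on the open set W;
  G k is the k-th derivative with respect to the parameter.
\<close>

definition mixed_reg ::
  "enat \<Rightarrow> real set \<Rightarrow> complex set \<Rightarrow> (real \<Rightarrow> complex \<Rightarrow> complex) \<Rightarrow> bool" where
  "mixed_reg d V W f \<longleftrightarrow>
     (\<exists>G. (\<forall>u\<in>V. \<forall>z\<in>W. G 0 u z = f u z) \<and>
        (\<forall>k. enat k \<le> d \<longrightarrow> (\<forall>u\<in>V. Cinf_on W (G k u) \<and> Cinf_tendsto W (G k) (G k u) (at u))) \<and>
        (\<forall>k. enat k < d \<longrightarrow> (\<forall>u\<in>V.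
           Cinf_tendsto W (\<lambda>s z. (G k s z - G k u z) / of_real (s - u)) (G (Suc k) u) (at u))))"

definition mat_d_z :: "(complex \<Rightarrow> complex mat) \<Rightarrow> complex \<Rightarrow> complex mat" where
  "mat_d_z M z =
     Matrix.mat (dim_row (M z)) (dim_col (M z)) (\<lambda>(i, j). d_z (\<lambda>w. M w $$ (i, j)) z)"

definition mat_d_zbar :: "(complex \<Rightarrow> complex mat) \<Rightarrow> complex \<Rightarrow> complex mat" where
  "mat_d_zbar M z =
     Matrix.mat (dim_row (M z)) (dim_col (M z)) (\<lambda>(i, j). d_zbar (\<lambda>w. M w $$ (i, j)) z)"

definition smooth_mat ::
  "complex set \<Rightarrow> complex set \<Rightarrow> nat \<Rightarrow> nat \<Rightarrow> (complex \<Rightarrow> complex mat) \<Rightarrow> bool" where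
  "smooth_mat L W m n M \<longleftrightarrow>
     (\<forall>z\<in>W. M z \<in> carrier_mat m n) \<and> periodic_on L W M \<and>
     (\<forall>i<m. \<forall>j<n. Cinf_on W (\<lambda>z. M z $$ (i, j)))"

text \<open>The sizes m, n are locally constant functions of the parameter, as ranks may jump between
  components of V.\<close>

definition mixed_mat ::
  "enat \<Rightarrow> real set \<Rightarrow> complex set \<Rightarrow> (real \<Rightarrow> nat) \<Rightarrow> (real \<Rightarrow> nat) \<Rightarrow>
   (real \<Rightarrow> complex \<Rightarrow> complex mat) \<Rightarrow> bool" where
  "mixed_mat d V W m n M \<longleftrightarrow>
     (\<forall>i j. mixed_reg d {u\<in>V. i < m u \<and> j < n u} W (\<lambda>u z. M u z $$ (i, j)))"


section \<open>Higgs bundles on the elliptic curve\<close>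

text \<open>
  A bundle is given by local trivialisations indexed by \<^term>\<open>bcharts E\<close>; coordinates transform by
  s c = btrans c c' * s c'.  In the trivialisation c the Higgs operator is
  dbar + bdbar c dz-bar + bphi c dz.
\<close>

record higgs =
  bcharts :: "nat set"
  bdom :: "nat \<Rightarrow> complex set"
  brank :: nat
  btrans :: "nat \<Rightarrow> nat \<Rightarrow> complex \<Rightarrow> complex mat"
  bdbar :: "nat \<Rightarrow> complex \<Rightarrow> complex mat"
  bphi :: "nat \<Rightarrow> complex \<Rightarrow> complex mat"

text \<open>
  On a curve the square of the Higgs operator reduces to the condition that the Higgs field be
  holomorphic.
\<close>

definition higgs_bundle :: "complex set \<Rightarrow> higgs \<Rightarrow> bool" where
  "higgs_bundle L E \<longleftrightarrow>
     (\<forall>c\<in>bcharts E. torus_open L (bdom E c)) \<and>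
     (\<Union>c\<in>bcharts E. bdom E c) = UNIV \<and>
     (\<forall>c\<in>bcharts E. \<forall>e\<in>bcharts E.
        smooth_mat L (bdom E c \<inter> bdom E e) (brank E) (brank E) (btrans E c e)) \<and>
     (\<forall>c\<in>bcharts E. \<forall>z\<in>bdom E c. btrans E c c z = 1\<^sub>m (brank E)) \<and>
     (\<forall>c\<in>bcharts E. \<forall>e\<in>bcharts E. \<forall>k\<in>bcharts E. \<forall>z\<in>bdom E c \<inter> bdom E e \<inter> bdom E k.
        btrans E c e z * btrans E e k z = btrans E c k z) \<and>
     (\<forall>c\<in>bcharts E. smooth_mat L (bdom E c) (brank E) (brank E) (bdbar E c) \<and>
                     smooth_mat L (bdom E c) (brank E) (brank E) (bphi E c)) \<and>
     (\<forall>c\<in>bcharts E. \<forall>e\<in>bcharts E. \<forall>z\<in>bdom E c \<inter> bdom E e.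
        mat_d_zbar (btrans E c e) z + bdbar E c z * btrans E c e z = btrans E c e z * bdbar E e z \<and>
        bphi E c z * btrans E c e z = btrans E c e z * bphi E e z) \<and>
     (\<forall>c\<in>bcharts E. \<forall>z\<in>bdom E c.
        mat_d_zbar (bphi E c) z + bdbar E c z * bphi E c z - bphi E c z * bdbar E c z
          = 0\<^sub>m (brank E) (brank E))"

text \<open>A morphism from E to F; the first index is a chart of the target.\<close>

definition higgs_morphism ::
  "complex set \<Rightarrow> higgs \<Rightarrow> higgs \<Rightarrow> (nat \<Rightarrow> nat \<Rightarrow> complex \<Rightarrow> complex mat) \<Rightarrow> bool" where
  "higgs_morphism L E F f \<longleftrightarrow>
     (\<forall>c\<in>bcharts F. \<forall>e\<in>bcharts E.
        smooth_mat L (bdom F c \<inter> bdom E e) (brank F) (brank E) (f c e)) \<and>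
     (\<forall>c\<in>bcharts F. \<forall>c'\<in>bcharts F. \<forall>e\<in>bcharts E. \<forall>e'\<in>bcharts E.
        \<forall>z\<in>bdom F c \<inter> bdom F c' \<inter> bdom E e \<inter> bdom E e'.
          f c e z = btrans F c c' z * f c' e' z * btrans E e' e z) \<and>
     (\<forall>c\<in>bcharts F. \<forall>e\<in>bcharts E. \<forall>z\<in>bdom F c \<inter> bdom E e.
        mat_d_zbar (f c e) z + bdbar F c z * f c e z = f c e z * bdbar E e z \<and>
        bphi F c z * f c e z = f c e z * bphi E e z)"

definition mat_range :: "complex mat \<Rightarrow> complex vec set" where
  "mat_range A = {A *\<^sub>v v | v. v \<in> carrier_vec (dim_col A)}"

definition mat_ker :: "complex mat \<Rightarrow> complex vec set" where
  "mat_ker A = {v \<in> carrier_vec (dim_col A). A *\<^sub>v v = 0\<^sub>v (dim_row A)}"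

definition fibre_injective ::
  "higgs \<Rightarrow> higgs \<Rightarrow> (nat \<Rightarrow> nat \<Rightarrow> complex \<Rightarrow> complex mat) \<Rightarrow> bool" where
  "fibre_injective E F f \<longleftrightarrow>
     (\<forall>c\<in>bcharts F. \<forall>e\<in>bcharts E. \<forall>z\<in>bdom F c \<inter> bdom E e. mat_ker (f c e z) = {0\<^sub>v (brank E)})"

definition fibre_surjective ::
  "higgs \<Rightarrow> higgs \<Rightarrow> (nat \<Rightarrow> nat \<Rightarrow> complex \<Rightarrow> complex mat) \<Rightarrow> bool" where
  "fibre_surjective E F f \<longleftrightarrow>
     (\<forall>c\<in>bcharts F. \<forall>e\<in>bcharts E. \<forall>z\<in>bdom F c \<inter> bdom E e. mat_range (f c e z) = carrier_vec (brank F))"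


section \<open>Hermitian and harmonic metrics\<close>

text \<open>The metric is h(s,t) = t* H s in each trivialisation (linear in s).\<close>

definition pos_def_hermitian :: "nat \<Rightarrow> complex mat \<Rightarrow> bool" where
  "pos_def_hermitian n H \<longleftrightarrow>
     H \<in> carrier_mat n n \<and> mat_adjoint H = H \<and>
     (\<forall>v\<in>carrier_vec n. v \<noteq> 0\<^sub>v n \<longrightarrow> Re ((H *\<^sub>v v) \<bullet>c v) > 0)"

definition hermitian_metric ::
  "complex set \<Rightarrow> higgs \<Rightarrow> (nat \<Rightarrow> complex \<Rightarrow> complex mat) \<Rightarrow> bool" where
  "hermitian_metric L E H \<longleftrightarrow>
     (\<forall>c\<in>bcharts E. smooth_mat L (bdom E c) (brank E) (brank E) (H c)) \<and>
     (\<forall>c\<in>bcharts E. \<forall>z\<in>bdom E c. pos_def_hermitian (brank E) (H c z)) \<and>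
     (\<forall>c\<in>bcharts E. \<forall>e\<in>bcharts E. \<forall>z\<in>bdom E c \<inter> bdom E e.
        mat_adjoint (btrans E c e z) * H c z * btrans E c e z = H e z)"

text \<open>
  The (1,0)-part of the Chern connection is d_z + A, where A is determined by
  d_z h(s,t) = h((d_z + A) s, t) + h(s, (d_zbar + B) t).
\<close>

definition chern_10 ::
  "nat \<Rightarrow> complex set \<Rightarrow> (complex \<Rightarrow> complex mat) \<Rightarrow> (complex \<Rightarrow> complex mat) \<Rightarrow>
   (complex \<Rightarrow> complex mat) \<Rightarrow> bool" where
  "chern_10 n W B H A \<longleftrightarrow>
     (\<forall>z\<in>W. A z \<in> carrier_mat n n \<and> mat_d_z H z = H z * A z + mat_adjoint (B z) * H z)"

text \<open>The adjoint of the Higgs field P dz is T dz-bar with h(P s, t) = h(s, T t).\<close>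

definition higgs_adjoint ::
  "nat \<Rightarrow> complex set \<Rightarrow> (complex \<Rightarrow> complex mat) \<Rightarrow> (complex \<Rightarrow> complex mat) \<Rightarrow>
   (complex \<Rightarrow> complex mat) \<Rightarrow> bool" where
  "higgs_adjoint n W P H T \<longleftrightarrow>
     (\<forall>z\<in>W. T z \<in> carrier_mat n n \<and> H z * P z = mat_adjoint (T z) * H z)"

text \<open>The coefficient of dz \<and> dz-bar in the curvature of d + M dz + N dz-bar.\<close>

definition curvature ::
  "(complex \<Rightarrow> complex mat) \<Rightarrow> (complex \<Rightarrow> complex mat) \<Rightarrow> complex \<Rightarrow> complex mat" where
  "curvature M N z = mat_d_z N z - mat_d_zbar M z + (M z * N z - N z * M z)"

definition harmonic_metric ::
  "complex set \<Rightarrow> higgs \<Rightarrow> (nat \<Rightarrow> complex \<Rightarrow> complex mat) \<Rightarrow> bool" where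
  "harmonic_metric L E H \<longleftrightarrow>
     hermitian_metric L E H \<and>
     (\<forall>c\<in>bcharts E. \<exists>A T.
        chern_10 (brank E) (bdom E c) (bdbar E c) (H c) A \<and>
        higgs_adjoint (brank E) (bdom E c) (bphi E c) (H c) T \<and>
        (\<forall>z\<in>bdom E c.
           curvature (\<lambda>w. A w + bphi E c w) (\<lambda>w. bdbar E c w + T w) z = 0\<^sub>m (brank E) (brank E)))"


section \<open>Stability\<close>

text \<open>
  The degree is (i/2pi) times the integral of the trace of the curvature of the Chern connection
  of any Hermitian metric; the factor pi arises from dz \<and> dz-bar = -2i dx \<and> dy.
\<close>

definition has_degree :: "complex set \<Rightarrow> higgs \<Rightarrow> real \<Rightarrow> bool" where
  "has_degree L E d \<longleftrightarrow>
     (\<exists>H A r w1 w2.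
        hermitian_metric L E H \<and>
        (\<forall>c\<in>bcharts E. chern_10 (brank E) (bdom E c) (bdbar E c) (H c) (A c) \<and>
           (\<forall>z\<in>bdom E c. r z = (\<Sum>i<brank E. curvature (A c) (bdbar E c) z $$ (i, i)))) \<and>
        is_lattice_basis L w1 w2 \<and>
        (r has_integral of_real (pi * d)) (period_parallelogram w1 w2))"

definition stable :: "complex set \<Rightarrow> higgs \<Rightarrow> bool" where
  "stable L E \<longleftrightarrow>
     higgs_bundle L E \<and> brank E > 0 \<and>
     (\<forall>F f. higgs_bundle L F \<and> higgs_morphism L F E f \<and> fibre_injective F E f \<and>
        0 < brank F \<and> brank F < brank E \<longrightarrow>
        (\<forall>dF dE. has_degree L F dF \<and> has_degree L E dE \<longrightarrow>
           dF / real (brank F) < dE / real (brank E)))"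

definition polystable :: "complex set \<Rightarrow> higgs \<Rightarrow> bool" where
  "polystable L E \<longleftrightarrow>
     higgs_bundle L E \<and>
     (\<exists>m S f slope.
        (\<forall>k<m. stable L (S k) \<and> higgs_morphism L (S k) E (f k) \<and>
           (\<exists>d. has_degree L (S k) d \<and> d / real (brank (S k)) = slope)) \<and>
        (\<forall>c\<in>bcharts E. \<forall>z\<in>bdom E c. \<forall>e. (\<forall>k<m. e k \<in> bcharts (S k) \<and> z \<in> bdom (S k) (e k)) \<longrightarrow>
           (\<forall>v\<in>carrier_vec (brank E). \<exists>!w. w \<in> (\<Pi>\<^sub>E k\<in>{..<m::nat}. carrier_vec (brank (S k))) \<and>
              (\<forall>i<brank E. vec_index v i = (\<Sum>k<m. vec_index (f k c (e k) z *\<^sub>v w k) i)))))"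


section \<open>Families over open subsets of the real line\<close>

record family =
  fcharts :: "nat set"
  fudom :: "nat \<Rightarrow> real set"
  fxdom :: "nat \<Rightarrow> complex set"
  frank :: "real \<Rightarrow> nat"
  ftrans :: "nat \<Rightarrow> nat \<Rightarrow> real \<Rightarrow> complex \<Rightarrow> complex mat"
  fdbar :: "nat \<Rightarrow> real \<Rightarrow> complex \<Rightarrow> complex mat"
  fphi :: "nat \<Rightarrow> real \<Rightarrow> complex \<Rightarrow> complex mat"

definition slice :: "real \<Rightarrow> family \<Rightarrow> higgs" where
  "slice u E =
     \<lparr>bcharts = {c \<in> fcharts E. u \<in> fudom E c}, bdom = fxdom E, brank = frank E u,
      btrans = (\<lambda>c e. ftrans E c e u), bdbar = (\<lambda>c. fdbar E c u), bphi = (\<lambda>c. fphi E c u)\<rparr>"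

definition restrict_family :: "real set \<Rightarrow> family \<Rightarrow> family" where
  "restrict_family V E = E\<lparr>fudom := (\<lambda>c. fudom E c \<inter> V)\<rparr>"

text \<open>
  The last clause says that near every parameter the charts J identify the bundle with the
  pullback of a fixed bundle on X.
\<close>

definition higgs_family :: "complex set \<Rightarrow> enat \<Rightarrow> real set \<Rightarrow> family \<Rightarrow> bool" where
  "higgs_family L d U E \<longleftrightarrow>
     (\<forall>c\<in>fcharts E. open (fudom E c) \<and> fudom E c \<subseteq> U) \<and>
     (\<forall>u\<in>U. \<forall>\<^sub>F s in nhds u. frank E s = frank E u) \<and>
     (\<forall>u\<in>U. higgs_bundle L (slice u E)) \<and>
     (\<forall>c\<in>fcharts E. \<forall>e\<in>fcharts E.
        mixed_mat d (fudom E c \<inter> fudom E e) (fxdom E c \<inter> fxdom E e) (frank E) (frank E)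
          (ftrans E c e)) \<and>
     (\<forall>c\<in>fcharts E.
        mixed_mat d (fudom E c) (fxdom E c) (frank E) (frank E) (fdbar E c) \<and>
        mixed_mat d (fudom E c) (fxdom E c) (frank E) (frank E) (fphi E c)) \<and>
     (\<forall>u\<in>U. \<exists>N J. open N \<and> u \<in> N \<and> J \<subseteq> fcharts E \<and> (\<forall>c\<in>J. N \<subseteq> fudom E c) \<and>
        (\<Union>c\<in>J. fxdom E c) = UNIV \<and>
        (\<forall>c\<in>J. \<forall>e\<in>J. \<forall>s\<in>N. \<forall>z\<in>fxdom E c \<inter> fxdom E e. ftrans E c e s z = ftrans E c e u z))"

definition family_morphism ::
  "complex set \<Rightarrow> enat \<Rightarrow> real set \<Rightarrow> family \<Rightarrow> family \<Rightarrow>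
   (nat \<Rightarrow> nat \<Rightarrow> real \<Rightarrow> complex \<Rightarrow> complex mat) \<Rightarrow> bool" where
  "family_morphism L d U E F f \<longleftrightarrow>
     (\<forall>u\<in>U. higgs_morphism L (slice u E) (slice u F) (\<lambda>c e. f c e u)) \<and>
     (\<forall>c\<in>fcharts F. \<forall>e\<in>fcharts E.
        mixed_mat d (fudom F c \<inter> fudom E e) (fxdom F c \<inter> fxdom E e) (frank F) (frank E) (f c e))"

definition family_injective ::
  "real set \<Rightarrow> family \<Rightarrow> family \<Rightarrow> (nat \<Rightarrow> nat \<Rightarrow> real \<Rightarrow> complex \<Rightarrow> complex mat) \<Rightarrow> bool" where
  "family_injective U E F f \<longleftrightarrow>
     (\<forall>u\<in>U. fibre_injective (slice u E) (slice u F) (\<lambda>c e. f c e u))"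

definition family_surjective ::
  "real set \<Rightarrow> family \<Rightarrow> family \<Rightarrow> (nat \<Rightarrow> nat \<Rightarrow> real \<Rightarrow> complex \<Rightarrow> complex mat) \<Rightarrow> bool" where
  "family_surjective U E F f \<longleftrightarrow>
     (\<forall>u\<in>U. fibre_surjective (slice u E) (slice u F) (\<lambda>c e. f c e u))"

definition family_iso ::
  "complex set \<Rightarrow> enat \<Rightarrow> real set \<Rightarrow> family \<Rightarrow> family \<Rightarrow>
   (nat \<Rightarrow> nat \<Rightarrow> real \<Rightarrow> complex \<Rightarrow> complex mat) \<Rightarrow> bool" where
  "family_iso L d U E F f \<longleftrightarrow>
     family_morphism L d U E F f \<and> family_injective U E F f \<and> family_surjective U E F f"

definition short_exact ::
  "complex set \<Rightarrow> enat \<Rightarrow> real set \<Rightarrow> family \<Rightarrow> family \<Rightarrow> family \<Rightarrow>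
   (nat \<Rightarrow> nat \<Rightarrow> real \<Rightarrow> complex \<Rightarrow> complex mat) \<Rightarrow>
   (nat \<Rightarrow> nat \<Rightarrow> real \<Rightarrow> complex \<Rightarrow> complex mat) \<Rightarrow> bool" where
  "short_exact L d U A E C f g \<longleftrightarrow>
     family_morphism L d U A E f \<and> family_morphism L d U E C g \<and>
     family_injective U A E f \<and> family_surjective U E C g \<and>
     (\<forall>a\<in>fcharts A. \<forall>c\<in>fcharts E. \<forall>e\<in>fcharts C.
        \<forall>u\<in>fudom A a \<inter> fudom E c \<inter> fudom C e. \<forall>z\<in>fxdom A a \<inter> fxdom E c \<inter> fxdom C e.
          mat_range (f c a u z) = mat_ker (g e c u z))"

definition harmonic_metric_family ::
  "complex set \<Rightarrow> enat \<Rightarrow> real set \<Rightarrow> family \<Rightarrow> (nat \<Rightarrow> real \<Rightarrow> complex \<Rightarrow> complex mat) \<Rightarrow> bool" where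
  "harmonic_metric_family L d U E H \<longleftrightarrow>
     (\<forall>u\<in>U. harmonic_metric L (slice u E) (\<lambda>c. H c u)) \<and>
     (\<forall>c\<in>fcharts E. mixed_mat d (fudom E c) (fxdom E c) (frank E) (frank E) (H c))"

definition metrics_continuous_at ::
  "family \<Rightarrow> (nat \<Rightarrow> real \<Rightarrow> complex \<Rightarrow> complex mat) \<Rightarrow> real \<Rightarrow> bool" where
  "metrics_continuous_at E H u0 \<longleftrightarrow>
     (\<forall>c\<in>fcharts E. u0 \<in> fudom E c \<longrightarrow>
        (\<forall>z\<in>fxdom E c. \<forall>i<frank E u0. \<forall>j<frank E u0. isCont (\<lambda>u. H c u z $$ (i, j)) u0))"


section \<open>Relative harmonic filtrations\<close>

text \<open>
  S c u z is a subspace of the fibre of E at (u,z), in coordinates of the chart c; the subbundle it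
  forms, with the induced Higgs operator, is the family F embedded by f.
\<close>

definition embedded_subfamily ::
  "complex set \<Rightarrow> enat \<Rightarrow> real set \<Rightarrow> family \<Rightarrow> (nat \<Rightarrow> real \<Rightarrow> complex \<Rightarrow> complex vec set) \<Rightarrow>
   family \<Rightarrow> (nat \<Rightarrow> nat \<Rightarrow> real \<Rightarrow> complex \<Rightarrow> complex mat) \<Rightarrow> bool" where
  "embedded_subfamily L d U E S F f \<longleftrightarrow>
     higgs_family L d U F \<and> family_morphism L d U F E f \<and> family_injective U F E f \<and>
     (\<forall>c\<in>fcharts E. \<forall>e\<in>fcharts F. \<forall>u\<in>fudom E c \<inter> fudom F e. \<forall>z\<in>fxdom E c \<inter> fxdom F e.
        S c u z = mat_range (f c e u z))"

definition invariant_subbundle ::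
  "complex set \<Rightarrow> enat \<Rightarrow> real set \<Rightarrow> family \<Rightarrow> (nat \<Rightarrow> real \<Rightarrow> complex \<Rightarrow> complex vec set) \<Rightarrow> bool" where
  "invariant_subbundle L d U E S \<longleftrightarrow> (\<exists>F f. embedded_subfamily L d U E S F f)"

definition subquotient ::
  "complex set \<Rightarrow> enat \<Rightarrow> real set \<Rightarrow> family \<Rightarrow> (nat \<Rightarrow> real \<Rightarrow> complex \<Rightarrow> complex vec set) \<Rightarrow>
   (nat \<Rightarrow> real \<Rightarrow> complex \<Rightarrow> complex vec set) \<Rightarrow> family \<Rightarrow> bool" where
  "subquotient L d U E S S' Q \<longleftrightarrow>
     higgs_family L d U Q \<and>
     (\<exists>F f q. embedded_subfamily L d U E S F f \<and>
        family_morphism L d U F Q q \<and> family_surjective U F Q q \<and>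
        (\<forall>c\<in>fcharts E. \<forall>e\<in>fcharts F. \<forall>k\<in>fcharts Q.
           \<forall>u\<in>fudom E c \<inter> fudom F e \<inter> fudom Q k. \<forall>z\<in>fxdom E c \<inter> fxdom F e \<inter> fxdom Q k.
             mat_ker (q k e u z) = {v \<in> carrier_vec (frank F u). f c e u z *\<^sub>v v \<in> S' c u z}))"

definition relative_harmonic_filtration ::
  "complex set \<Rightarrow> enat \<Rightarrow> real set \<Rightarrow> family \<Rightarrow> nat \<Rightarrow>
   (nat \<Rightarrow> nat \<Rightarrow> real \<Rightarrow> complex \<Rightarrow> complex vec set) \<Rightarrow> bool" where
  "relative_harmonic_filtration L d U E l S \<longleftrightarrow>
     higgs_family L d U E \<and>
     (\<forall>i\<le>l. invariant_subbundle L d U E (S i)) \<and>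
     (\<forall>c\<in>fcharts E. \<forall>u\<in>fudom E c. \<forall>z\<in>fxdom E c.
        S 0 c u z = {0\<^sub>v (frank E u)} \<and> S l c u z = carrier_vec (frank E u) \<and>
        (\<forall>i<l. S i c u z \<subseteq> S (Suc i) c u z)) \<and>
     (\<forall>i<l. \<exists>Q H. subquotient L d U E (S (Suc i)) (S i) Q \<and> harmonic_metric_family L d U Q H)"


section \<open>The stack generated by harmonic families\<close>

text \<open>Objects over V of the prestack generated by finite iterated extensions.\<close>

inductive extension_generated :: "complex set \<Rightarrow> enat \<Rightarrow> real set \<Rightarrow> family \<Rightarrow> bool"
  for L d V where
  harmonic: "higgs_family L d V E \<Longrightarrow> harmonic_metric_family L d V E H \<Longrightarrow>
    extension_generated L d V E"
| extension: "extension_generated L d V A \<Longrightarrow> extension_generated L d V C \<Longrightarrow>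
    higgs_family L d V E \<Longrightarrow> short_exact L d V A E C f g \<Longrightarrow> extension_generated L d V E"

text \<open>
  Objects of the stackification over U are descent data in the prestack for open covers of U.
\<close>

definition descent_datum ::
  "complex set \<Rightarrow> enat \<Rightarrow> real set \<Rightarrow> real set set \<Rightarrow> (real set \<Rightarrow> family) \<Rightarrow>
   (real set \<Rightarrow> real set \<Rightarrow> nat \<Rightarrow> nat \<Rightarrow> real \<Rightarrow> complex \<Rightarrow> complex mat) \<Rightarrow> bool" where
  "descent_datum L d U \<V> P \<phi> \<longleftrightarrow>
     (\<forall>V\<in>\<V>. open V) \<and> \<Union>\<V> = U \<and>
     (\<forall>V\<in>\<V>. extension_generated L d V (P V)) \<and>
     (\<forall>V\<in>\<V>. \<forall>W\<in>\<V>. family_iso L d (V \<inter> W)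
        (restrict_family (V \<inter> W) (P W)) (restrict_family (V \<inter> W) (P V)) (\<phi> V W)) \<and>
     (\<forall>V\<in>\<V>. \<forall>W\<in>\<V>. \<forall>Z\<in>\<V>. \<forall>c\<in>fcharts (P V). \<forall>e\<in>fcharts (P W). \<forall>k\<in>fcharts (P Z).
        \<forall>u\<in>fudom (P V) c \<inter> fudom (P W) e \<inter> fudom (P Z) k.
        \<forall>z\<in>fxdom (P V) c \<inter> fxdom (P W) e \<inter> fxdom (P Z) k.
          \<phi> V W c e u z * \<phi> W Z e k u z = \<phi> V Z c k u z)"

text \<open>
  Higgs families glue, so a family over U belongs to the stackification when it is the result of
  gluing some descent datum, i.e. is locally isomorphic to its objects compatibly with the
  gluing isomorphisms.
\<close>

definition in_harmonic_stack :: "complex set \<Rightarrow> enat \<Rightarrow> real set \<Rightarrow> family \<Rightarrow> bool" where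
  "in_harmonic_stack L d U E \<longleftrightarrow>
     higgs_family L d U E \<and>
     (\<exists>\<V> P \<phi> \<psi>. descent_datum L d U \<V> P \<phi> \<and>
        (\<forall>V\<in>\<V>. family_iso L d V (restrict_family V E) (P V) (\<psi> V)) \<and>
        (\<forall>V\<in>\<V>. \<forall>W\<in>\<V>. \<forall>c\<in>fcharts (P V). \<forall>e\<in>fcharts (P W). \<forall>k\<in>fcharts E.
           \<forall>u\<in>fudom (P V) c \<inter> fudom (P W) e \<inter> fudom E k.
           \<forall>z\<in>fxdom (P V) c \<inter> fxdom (P W) e \<inter> fxdom E k.
             \<phi> V W c e u z * \<psi> W e k u z = \<psi> V c k u z))"


section \<open>Families on the trivial holomorphic bundle\<close>

definition trivial_family :: "real set \<Rightarrow> nat \<Rightarrow> (real \<Rightarrow> complex \<Rightarrow> complex mat) \<Rightarrow> family" where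
  "trivial_family U n \<Theta> =
     \<lparr>fcharts = {0}, fudom = (\<lambda>_. U), fxdom = (\<lambda>_. UNIV), frank = (\<lambda>_. n),
      ftrans = (\<lambda>_ _ _ _. 1\<^sub>m n), fdbar = (\<lambda>_ _ _. 0\<^sub>m n n), fphi = (\<lambda>_. \<Theta>)\<rparr>"

end

theory Submission
  imports Defs "HOL-Complex_Analysis.Cauchy_Integral_Formula"
begin

text \<open>
  By Liouville the one-form has a constant coefficient, so the Higgs field is constant along the curve
  and polynomial in the parameter t. For t \<noteq> 0 the Higgs field has the two eigenvectors (1,0)
  and (1,t), which gives polystability; they become parallel as t tends to 0.

  Let h be a harmonic metric, e = (1,0), and let A and T be the coefficients of the Chern connection
  and of the adjoint Higgs field. As the Higgs field kills e, flatness yields the Bochner identity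
  d_zbar d_z h(e,e) = h(A e, A e) + h(T e, T e). The left side integrates to 0 over the torus, hence
  T e = 0. Thus e is orthogonal to the image of the Higgs field, which for t \<noteq> 0 is spanned by
  (1,t): h(e,e) + t h((0,1),e) = 0. Continuity at t = 0 would then force h(e,e) = 0 there.

  The line spanned by e is an invariant subbundle for all t, and both it and its
  quotient have rank 1, where a constant metric is harmonic.
\<close>

section \<open>Calculus on the torus\<close>

lemma dir_deriv_eq: "(f has_derivative f') (at z) \<Longrightarrow> dir_deriv v f z = f' v"
  unfolding dir_deriv_def by (metis frechet_derivative_at)

lemma d_z_eq: "(f has_derivative f') (at z) \<Longrightarrow> d_z f z = (f' 1 - \<i> * f' \<i>) / 2"
  and d_zbar_eq: "(f has_derivative f') (at z) \<Longrightarrow> d_zbar f z = (f' 1 + \<i> * f' \<i>) / 2"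
  by (simp_all add: d_z_def d_zbar_def dir_deriv_eq)

text \<open>A real linear map of the complex plane splits into a complex linear and a conjugate
  linear part, whose coefficients are the two Wirtinger derivatives. This links derivatives along
  periods with \<open>d_z\<close> and \<open>d_zbar\<close>.\<close>

lemma dir_deriv_conv_wirtinger:
  assumes "f differentiable at z"
  shows "dir_deriv v f z = v * d_z f z + cnj v * d_zbar f z"
proof -
  obtain f' where f': "(f has_derivative f') (at z)" using assms by (auto simp: differentiable_def)
  interpret linear f' using f' by (rule has_derivative_linear)
  have "f' v = f' (Re v *\<^sub>R 1 + Im v *\<^sub>R \<i>)"
    by (rule arg_cong[of _ _ f']) (simp add: complex_eq_iff)
  also have "\<dots> = Re v * f' 1 + Im v * f' \<i>"
    unfolding add scale by (simp add: scaleR_conv_of_real)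
  finally have *: "f' v = Re v * f' 1 + Im v * f' \<i>" .
  show ?thesis
    unfolding dir_deriv_eq[OF f'] d_z_eq[OF f'] d_zbar_eq[OF f'] *
    by (simp add: complex_eq_iff field_simps)
qed

lemma d_z_add:
  assumes "f differentiable at z" "g differentiable at z"
  shows "d_z (\<lambda>w. f w + g w) z = d_z f z + d_z g z"
    and "d_zbar (\<lambda>w. f w + g w) z = d_zbar f z + d_zbar g z"
proof -
  obtain f' g' where d: "(f has_derivative f') (at z)" "(g has_derivative g') (at z)"
    using assms by (auto simp: differentiable_def)
  note s = has_derivative_add[OF d]
  show "d_z (\<lambda>w. f w + g w) z = d_z f z + d_z g z" "d_zbar (\<lambda>w. f w + g w) z
      = d_zbar f z + d_zbar g z"
    by (simp_all add: d_z_eq[OF s] d_zbar_eq[OF s] d_z_eq[OF d(1)] d_zbar_eq[OF d(1)]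
        d_z_eq[OF d(2)] d_zbar_eq[OF d(2)] field_simps)
qed

lemma d_z_mult:
  assumes "f differentiable at z" "g differentiable at z"
  shows "d_z (\<lambda>w. f w * g w) z = d_z f z * g z + f z * d_z g z"
    and "d_zbar (\<lambda>w. f w * g w) z = d_zbar f z * g z + f z * d_zbar g z"
proof -
  obtain f' g' where d: "(f has_derivative f') (at z)" "(g has_derivative g') (at z)"
    using assms by (auto simp: differentiable_def)
  note s = has_derivative_mult[OF d]
  show "d_z (\<lambda>w. f w * g w) z = d_z f z * g z + f z * d_z g z"
    "d_zbar (\<lambda>w. f w * g w) z = d_zbar f z * g z + f z * d_zbar g z"
    by (simp_all add: d_z_eq[OF s] d_zbar_eq[OF s] d_z_eq[OF d(1)] d_zbar_eq[OF d(1)]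
        d_z_eq[OF d(2)] d_zbar_eq[OF d(2)] field_simps)
qed

text \<open>Conjugation commutes with real differentiation and exchanges the two Wirtinger
  derivatives. It will turn the Chern equations, which contain only \<open>d_z\<close>, into
  formulas for \<open>d_zbar\<close>.\<close>

lemma d_zbar_conv_d_z_cnj:
  assumes "f differentiable at z"
  shows "d_zbar f z = cnj (d_z (\<lambda>w. cnj (f w)) z)"
proof -
  obtain f' where d: "(f has_derivative f') (at z)" using assms by (auto simp: differentiable_def)
  show ?thesis
    by (simp add: d_zbar_eq[OF d] d_z_eq[OF bounded_linear.has_derivative[OF bounded_linear_cnj d]])
qed

section \<open>Stability of smooth and periodic functions under differentiation\<close>

lemma Cinf_on_UNIV_differentiable: "Cinf_on UNIV f \<Longrightarrow> iter_deriv vs f differentiable at z"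
  by (simp add: Cinf_on_def differentiable_on_def)

lemma Cinf_on_UNIV_continuous: "Cinf_on UNIV f \<Longrightarrow> continuous_on UNIV f"
  using Cinf_on_UNIV_differentiable[of f "[]"]
  by (intro differentiable_imp_continuous_on) (auto simp: differentiable_on_def iter_deriv_def)

lemma Cinf_on_dir_deriv: "Cinf_on W f \<Longrightarrow> Cinf_on W (dir_deriv v f)"
  unfolding Cinf_on_def by (metis foldr_append foldr_Cons foldr_Nil comp_apply id_apply
      iter_deriv_def)

text \<open>Linearity of \<open>frechet_derivative\<close> is available where both functions are
  differentiable; smoothness provides this at every stage of the induction.\<close>

lemma iter_deriv_linear_combination:
  assumes "Cinf_on UNIV f" "Cinf_on UNIV g"
  shows "iter_deriv vs (\<lambda>z. a * f z + b * g z) = (\<lambda>z. a * iter_deriv vs f z + b * iter_deriv vs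
      g z)"
proof (induction vs)
  case (Cons v vs)
  have "dir_deriv v (\<lambda>z. a * iter_deriv vs f z + b * iter_deriv vs g z) z
      = a * dir_deriv v (iter_deriv vs f) z + b * dir_deriv v (iter_deriv vs g) z" for z
  proof -
    obtain f1 g1 where d: "(iter_deriv vs f has_derivative f1) (at z)"
        "(iter_deriv vs g has_derivative g1) (at z)"
      using assms[THEN Cinf_on_UNIV_differentiable] by (meson differentiable_def)
    show ?thesis
      using dir_deriv_eq[OF d(1)] dir_deriv_eq[OF d(2)]
        dir_deriv_eq[OF has_derivative_add[OF has_derivative_mult_right[OF d(1)]
            has_derivative_mult_right[OF d(2)]]]
      by simp
  qed
  with Cons show ?case by (auto simp: iter_deriv_def)
qed (simp add: iter_deriv_def)

lemma Cinf_on_linear_combination: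
  assumes "Cinf_on UNIV f" "Cinf_on UNIV g"
  shows "Cinf_on UNIV (\<lambda>z. a * f z + b * g z)"
  using assms unfolding Cinf_on_def iter_deriv_linear_combination[OF assms]
  by (auto simp: differentiable_on_def)

lemma Cinf_on_d_z: "Cinf_on UNIV f \<Longrightarrow> Cinf_on UNIV (d_z f)"
  and Cinf_on_d_zbar: "Cinf_on UNIV f \<Longrightarrow> Cinf_on UNIV (d_zbar f)"
proof -
  have "d_z f = (\<lambda>z. (1/2) * dir_deriv 1 f z + (- \<i> / 2) * dir_deriv \<i> f z)"
    "d_zbar f = (\<lambda>z. (1/2) * dir_deriv 1 f z + (\<i> / 2) * dir_deriv \<i> f z)"
    by (simp_all add: d_z_def d_zbar_def fun_eq_iff field_simps)
  then show "Cinf_on UNIV f \<Longrightarrow> Cinf_on UNIV (d_z f)" "Cinf_on UNIV f \<Longrightarrow> Cinf_on UNIV (d_zbar f)"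
    by (simp_all only: Cinf_on_linear_combination Cinf_on_dir_deriv)
qed

text \<open>Translation by a period has the identity as its differential. Periodicity is wanted for
  the derivative because the integration argument below is applied to a derivative of the
  metric.\<close>

lemma periodic_on_d_z:
  assumes "periodic_on L UNIV f" "\<And>z. f differentiable at z"
  shows "periodic_on L UNIV (d_z f)"
proof -
  have "dir_deriv v f (z + l) = dir_deriv v f z" if "l \<in> L" for v z l
  proof -
    obtain f' where d: "(f has_derivative f') (at (z + l))"
      using assms(2) by (meson differentiable_def)
    have "((\<lambda>w. w + l) has_derivative (\<lambda>h. h)) (at z)"
      by (auto intro!: derivative_eq_intros)
    from has_derivative_compose[OF this d] have "((\<lambda>w. f (w + l)) has_derivative f') (at z)" .
    moreover have "(\<lambda>w. f (w + l)) = f" using assms(1) that by (auto simp: periodic_on_def)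
    ultimately show ?thesis using d by (simp add: dir_deriv_eq)
  qed
  then show ?thesis by (simp add: periodic_on_def d_z_def)
qed

text \<open>In the coordinates z = s w1 + t w2 a nonzero multiple of d_zbar \<phi> is w2 \<phi>_s - w1 \<phi>_t, whose
  integral over a period parallelogram vanishes.\<close>

lemma periodic_d_zbar_nonneg_imp_zero:
  assumes L: "is_lattice L" and per: "periodic_on L UNIV \<phi>"
    and diff: "\<And>z. \<phi> differentiable at z"
    and cont: "continuous_on UNIV (d_z \<phi>)" "continuous_on UNIV (d_zbar \<phi>)"
    and nonneg: "\<And>z. d_zbar \<phi> z \<in> \<real>" "\<And>z. Re (d_zbar \<phi> z) \<ge> 0"
  shows "d_zbar \<phi> z0 = 0"
proof -
  obtain w1 w2 where w: "is_lattice_basis L w1 w2" using L by (auto simp: is_lattice_def)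
  then have "1 * w1 + 0 * w2 \<in> L" "0 * w1 + 1 * w2 \<in> L"
    unfolding is_lattice_basis_def by (metis (mono_tags, lifting) mem_Collect_eq of_int_0 of_int_1)+
  then have shift: "\<phi> (z + w1) = \<phi> z" "\<phi> (z + w2) = \<phi> z" for z
    using per by (auto simp: periodic_on_def)
  \<comment> \<open>Up to sign, the determinant of the linear system expressing the derivatives
    along \<open>w1\<close> and \<open>w2\<close> through \<open>d_z\<close> and
    \<open>d_zbar\<close>.\<close>
  define D where "D = w2 * cnj w1 - w1 * cnj w2"
  have "Im D \<noteq> 0" using w by (auto simp: D_def is_lattice_basis_def algebra_simps)
  then have "D \<noteq> 0" by auto
  \<comment> \<open>The parallelogram has its corner at the arbitrary point \<open>z0\<close>, so
    vanishing at the parameter (0, 0) will be enough.\<close>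
  define c where "c x = z0 + of_real (fst x) * w1 + of_real (snd x) * w2" for x :: "real \<times> real"
  define X where "X w x = dir_deriv w \<phi> (c x)" for w x
  have dir: "dir_deriv w \<phi> = (\<lambda>z. w * d_z \<phi> z + cnj w * d_zbar \<phi> z)" for w
    using dir_deriv_conv_wirtinger[OF diff] by blast
  have contX: "continuous_on S (X w)" for w S
    unfolding X_def[abs_def] dir c_def
    by (intro continuous_intros continuous_on_compose2[OF cont(1)] continuous_on_compose2[OF
        cont(2)]) auto
  have vd: "((\<lambda>s. \<phi> (b + of_real s * w)) has_vector_derivative dir_deriv w \<phi> (b + of_real s *
      w)) (at s within T)"
    for b w s T
  proof -
    obtain f' where d: "(\<phi> has_derivative f') (at (b + of_real s * w))"
      using diff by (meson differentiable_def)
    have "((\<lambda>s. b + of_real s * w) has_derivative (\<lambda>h. of_real h * w)) (at s within T)"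
      by (auto intro!: derivative_eq_intros)
    from has_derivative_compose[OF this d]
    have "((\<lambda>s. \<phi> (b + of_real s * w)) has_derivative (\<lambda>h. f' (of_real h * w))) (at s within T)" .
    moreover have "f' (of_real h * w) = h *\<^sub>R f' w" for h
      using linear_scale[OF has_derivative_linear[OF d], of h w] by (simp add: scaleR_conv_of_real)
    ultimately show ?thesis
      by (simp add: has_vector_derivative_def dir_deriv_eq[OF d])
  qed
  \<comment> \<open>By the fundamental theorem the integral along a period is the difference of
    \<phi> at the two ends of the segment.\<close>
  have int0: "integral (cbox 0 1) (\<lambda>s. dir_deriv w \<phi> (b + of_real s * w)) = 0"
    if "\<And>z. \<phi> (z + w) = \<phi> z" for b w
    using fundamental_theorem_of_calculus[OF _ vd, of 0 1 w b] that by (simp add: integral_unique)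
  \<comment> \<open>The iterated integral has the second coordinate innermost, so the order is
    exchanged in order to integrate first in the direction \<open>w1\<close>.\<close>
  have "integral (cbox (0,0) (1,1)) (X w1) = integral (cbox 0 1) (\<lambda>t. integral (cbox 0 1)
      (\<lambda>s. X w1 (s, t)))"
    unfolding integral_prod_continuous[OF contX]
    by (rule integral_swap_continuous) (simp add: contX)
  moreover have "X w1 (s, t) = dir_deriv w1 \<phi> ((z0 + of_real t * w2) + of_real s * w1)" for s t
    by (simp add: X_def c_def algebra_simps)
  ultimately have X1: "integral (cbox (0,0) (1,1)) (X w1) = 0"
    by (simp only: int0 shift integral_0)
  have X2: "integral (cbox (0,0) (1,1)) (X w2) = 0"
    unfolding integral_prod_continuous[OF contX] X_def c_def fst_conv snd_conv
    by (simp only: int0 shift integral_0)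
  have f: "d_zbar \<phi> (c x) = (w2 * X w1 x - w1 * X w2 x) / D" for x
    using \<open>D \<noteq> 0\<close> by (simp add: X_def dir D_def field_simps)
  have hi: "(X w has_integral integral (cbox (0,0) (1,1)) (X w)) (cbox (0,0) (1,1))" for w
    by (intro integrable_integral integrable_continuous contX)
  have "((\<lambda>x. d_zbar \<phi> (c x)) has_integral (w2 * 0 - w1 * 0) / D) (cbox (0,0) (1,1))"
    unfolding f
    by (intro has_integral_divide has_integral_diff has_integral_mult_right)
      (use hi[of w1] hi[of w2] in \<open>simp_all add: X1 X2\<close>)
  from has_integral_linear[OF this bounded_linear_Re]
  have "((\<lambda>x. Re (d_zbar \<phi> (c x))) has_integral 0) (cbox (0,0) (1,1))"
    by (simp add: comp_def)
  moreover have "continuous_on (cbox (0,0) (1,1)) (\<lambda>x. Re (d_zbar \<phi> (c x)))"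
    unfolding f by (intro continuous_intros contX) (simp add: \<open>D \<noteq> 0\<close>)
  moreover have "box (0,0) (1::real,1::real) \<noteq> {}"
    by (auto simp: box_ne_empty Basis_prod_def)
  ultimately have "Re (d_zbar \<phi> (c (0,0))) = 0"
    using has_integral_0_cbox_imp_0[of "(0,0)" "(1,1)" "\<lambda>x. Re (d_zbar \<phi> (c x))" "(0,0)"] nonneg(2)
    by (auto simp: cbox_Pair_eq)
  then show ?thesis
    using nonneg(1)[of z0] by (auto simp: c_def complex_eq_iff complex_is_Real_iff)
qed

text \<open>Periodicity confines all values to the image of a compact parallelogram, so
  \<open>a\<close> is a bounded entire function and Liouville's theorem applies.\<close>

lemma lattice_periodic_holomorphic_const:
  assumes "is_lattice L" "a holomorphic_on UNIV" "periodic_on L UNIV a"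
  obtains c where "a = (\<lambda>_. c)"
proof -
  obtain w1 w2 where w: "Im (w1 * cnj w2) \<noteq> 0"
    and L: "L = {of_int m * w1 + of_int n * w2 | m n. True}"
    using assms(1) by (auto simp: is_lattice_def is_lattice_basis_def)
  define g where "g x = of_real (fst x) * w1 + of_real (snd x) * w2" for x :: "real \<times> real"
  have "range a \<subseteq> a ` g ` ({0..1} \<times> {0..1})"
  proof
    fix b assume "b \<in> range a"
    then obtain z where b: "b = a z" by blast
    \<comment> \<open>Real coordinates of \<open>z\<close> in the basis \<open>w1\<close>,
      \<open>w2\<close>: multiplying by a conjugate and taking imaginary parts eliminates one
      coordinate at a time.\<close>
    define s t where "s = Im (z * cnj w2) / Im (w1 * cnj w2)"
      and "t = Im (w1 * cnj z) / Im (w1 * cnj w2)"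
    have "z = of_real s * w1 + of_real t * w2"
    proof -
      define d where "d = Im (w1 * cnj w2)"
      have sd: "s * d = Im (z * cnj w2)" and td: "t * d = Im (w1 * cnj z)"
        using w by (simp_all add: s_def t_def d_def)
      have "of_real d * z = of_real (s * d) * w1 + of_real (t * d) * w2"
        unfolding sd td by (simp add: d_def complex_eq_iff algebra_simps)
      then have "of_real d * z = of_real d * (of_real s * w1 + of_real t * w2)"
        by (simp add: algebra_simps)
      moreover have "d \<noteq> 0" using w by (simp add: d_def)
      ultimately show ?thesis by simp
    qed
    then have "z = g (frac s, frac t) + (of_int \<lfloor>s\<rfloor> * w1 + of_int \<lfloor>t\<rfloor> * w2)"
      by (simp add: g_def frac_def algebra_simps)
    moreover have "of_int \<lfloor>s\<rfloor> * w1 + of_int \<lfloor>t\<rfloor> * w2 \<in> L" by (auto simp: L)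
    ultimately have "b = a (g (frac s, frac t))"
      using assms(3) b by (simp add: periodic_on_def)
    then show "b \<in> a ` g ` ({0..1} \<times> {0..1})"
      by (auto simp: frac_ge_0 frac_lt_1 less_imp_le)
  qed
  moreover have "compact (a ` g ` ({0..1} \<times> {0..1}))"
  proof (intro compact_continuous_image compact_Times)
    show "continuous_on ({0..1} \<times> {0..1}) g" unfolding g_def by (intro continuous_intros)
    show "continuous_on (g ` ({0..1} \<times> {0..1})) a"
      using holomorphic_on_imp_continuous_on[OF assms(2)] continuous_on_subset by blast
  qed auto
  ultimately have "bounded (range a)" using bounded_subset compact_imp_bounded by blast
  then show ?thesis
    using Liouville_theorem[OF assms(2)] that by (auto simp: constant_on_def fun_eq_iff)
qed

section \<open>Harmonic metrics of rank 2\<close>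

text \<open>Written by rows, the metric is ((p, q), (cnj q, r)), the Higgs field ((0, x), (0, y)), its adjoint
  ((t0, s0), (t1, s1)) and the coefficient of the Chern connection ((a0, b0), (a1, b1)).\<close>

lemma flat_rank_2_kernel_orthogonal:
  assumes L: "is_lattice L"
    and smooth: "Cinf_on UNIV p" "Cinf_on UNIV q" "Cinf_on UNIV (\<lambda>z. cnj (q z))" "Cinf_on UNIV r"
    and per: "periodic_on L UNIV p"
    and real: "\<And>z. cnj (p z) = p z" "\<And>z. cnj (r z) = r z"
    and pos: "\<And>z \<xi> \<eta>. \<xi> \<noteq> 0 \<or> \<eta> \<noteq> 0 \<Longrightarrow>
       0 < Re (cnj \<xi> * (p z * \<xi> + q z * \<eta>) + cnj \<eta> * (cnj (q z) * \<xi> + r z * \<eta>))"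
    and chern: "\<And>z. d_z p z = p z * a0 z + q z * a1 z" "\<And>z. d_z q z = p z * b0 z + q z * b1 z"
      "\<And>z. d_z (\<lambda>w. cnj (q w)) z = cnj (q z) * a0 z + r z * a1 z"
    and adj: "\<And>z. p z * t0 z + q z * t1 z = 0" "\<And>z. p z * s0 z + q z * s1 z = 0"
      "\<And>z. p z * x + q z * y = cnj (t0 z) * q z + cnj (t1 z) * r z"
    and curv: "\<And>z. d_z t0 z - d_zbar a0 z + ((a0 z * t0 z + (b0 z + x) * t1 z) - (t0 z * a0 z +
        s0 z * a1 z)) = 0"
      "\<And>z. d_z t1 z - d_zbar a1 z + ((a1 z * t0 z + (b1 z + y) * t1 z) - (t1 z * a0 z + s1 z *
          a1 z)) = 0"
  shows "p z * x + q z * y = 0"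
proof -
  \<comment> \<open>The determinant of the metric, the common denominator in solving the Chern and
    adjoint equations.\<close>
  define \<Delta> where "\<Delta> z = p z * r z - q z * cnj (q z)" for z
  have p0: "p z \<noteq> 0" for z using pos[of 1 0 z] by auto
  have \<Delta>0: "\<Delta> z \<noteq> 0" for z
  proof
    assume "\<Delta> z = 0"
    \<comment> \<open>Positivity is tested on (-q, p), which the metric maps to (0,
      \<Delta>).\<close>
    moreover have "0 < Re (cnj (p z) * \<Delta> z)"
      using pos[of "- q z" "p z" z] p0 by (simp add: \<Delta>_def algebra_simps)
    ultimately show False by simp
  qed
  have diff: "p differentiable at z" "q differentiable at z" "r differentiable at z" for z
    using smooth[THEN Cinf_on_UNIV_differentiable, of "[]"] by (auto simp: iter_deriv_def)
  have diff': "(\<lambda>w. cnj (q w)) differentiable at z" for z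
    using diff(2) by (simp add: differentiable_cnj_iff)
  \<comment> \<open>This is h((x, y), (1, 0)), the number to be shown to vanish.\<close>
  define e where "e z = p z * x + q z * y" for z
  \<comment> \<open>No regularity is assumed for the adjoint and connection coefficients. Cramer's
    rule writes their first columns as quotients of differentiable functions, which permits the
    product rule below.\<close>
  have t: "t0 = (\<lambda>z. - q z * cnj (e z) / \<Delta> z)" "t1 = (\<lambda>z. p z * cnj (e z) / \<Delta> z)"
  proof -
    have e: "cnj (e z) = t0 z * cnj (q z) + t1 z * r z" for z
      using arg_cong[OF adj(3)[of z], of cnj] real by (simp add: e_def)
    have "t0 z * \<Delta> z = - q z * cnj (e z)" "t1 z * \<Delta> z = p z * cnj (e z)" for z
    proof -
      have "t0 z * \<Delta> z = r z * (p z * t0 z + q z * t1 z) - q z * cnj (e z)"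
        "t1 z * \<Delta> z = p z * cnj (e z) - cnj (q z) * (p z * t0 z + q z * t1 z)"
        unfolding e \<Delta>_def by (simp_all add: algebra_simps)
      then show "t0 z * \<Delta> z = - q z * cnj (e z)" "t1 z * \<Delta> z = p z * cnj (e z)"
        by (simp_all add: adj(1))
    qed
    then show "t0 = (\<lambda>z. - q z * cnj (e z) / \<Delta> z)" "t1 = (\<lambda>z. p z * cnj (e z) / \<Delta> z)"
      using \<Delta>0 by (metis (no_types) nonzero_eq_divide_eq)+
  qed
  have a: "a0 = (\<lambda>z. (r z * d_z p z - q z * d_z (\<lambda>w. cnj (q w)) z) / \<Delta> z)"
    "a1 = (\<lambda>z. (p z * d_z (\<lambda>w. cnj (q w)) z - cnj (q z) * d_z p z) / \<Delta> z)"
    using \<Delta>0 by (simp_all add: fun_eq_iff eq_divide_eq chern) (simp_all add: \<Delta>_def algebra_simps)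
  have dd: "d_z p differentiable at z" "d_z (\<lambda>w. cnj (q w)) differentiable at z" for z
    using smooth[THEN Cinf_on_d_z, THEN Cinf_on_UNIV_differentiable, of "[]"]
        by (auto simp: iter_deriv_def)
  have diff\<Delta>: "\<Delta> differentiable at z" for z
    unfolding \<Delta>_def[abs_def] by (intro differentiable_diff differentiable_mult diff diff')
  have diffe: "(\<lambda>z. cnj (e z)) differentiable at z" for z
    unfolding e_def[abs_def] differentiable_cnj_iff
        by (intro differentiable_add differentiable_mult diff differentiable_const)
  have dt: "t0 differentiable at z" "t1 differentiable at z" for z
    unfolding t by (intro differentiable_divide differentiable_mult differentiable_minus diff
        diff\<Delta> diffe \<Delta>0)+
  have da: "a0 differentiable at z" "a1 differentiable at z" for z
    unfolding a by (intro differentiable_divide differentiable_mult differentiable_diff diff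
        diff' diff\<Delta> dd \<Delta>0)+
  \<comment> \<open>The squared norm of (\<xi>, \<eta>). At (a0, a1) and (t0, t1) it gives the
    squared norms of the images of (1, 0) under the connection coefficient and the adjoint Higgs
    field.\<close>
  define Q where "Q \<xi> \<eta> z = cnj \<xi> * (p z * \<xi> + q z * \<eta>) + cnj \<eta> * (cnj (q z) * \<xi> + r z * \<eta>)"
      for \<xi> \<eta> z
  have Q_real: "Q \<xi> \<eta> z \<in> \<real>" for \<xi> \<eta> z
    unfolding Reals_cnj_iff Q_def by (simp add: real algebra_simps)
  have Q_nonneg: "0 \<le> Re (Q \<xi> \<eta> z)" for \<xi> \<eta> z
    using pos[of \<xi> \<eta> z] by (cases "\<xi> \<noteq> 0 \<or> \<eta> \<noteq> 0") (auto simp: Q_def)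
  have main: "d_zbar (d_z p) z = Q (a0 z) (a1 z) z + Q (t0 z) (t1 z) z" for z
  proof -
    have "d_z p = (\<lambda>w. p w * a0 w + q w * a1 w)"
      using chern(1) by (rule ext)
    then have "d_zbar (d_z p) z = d_zbar (\<lambda>w. p w * a0 w + q w * a1 w) z" by simp
    also have "\<dots> = d_zbar p z * a0 z + p z * d_zbar a0 z + (d_zbar q z * a1 z + q z * d_zbar a1 z)"
      by (simp add: d_z_add d_z_mult differentiable_mult diff da)
    finally have 1: "d_zbar (d_z p) z = d_zbar p z * a0 z + p z * d_zbar a0 z + (d_zbar q z * a1
        z + q z * d_zbar a1 z)" .
    \<comment> \<open>Because \<open>p\<close> is real and the lower left entry of the metric is the
      conjugate of \<open>q\<close>, conjugating the Chern equations gives the (0,1)-derivatives of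
      the metric.\<close>
    have 2: "d_zbar p z = cnj (p z * a0 z + q z * a1 z)"
      using d_zbar_conv_d_z_cnj[OF diff(1)] real chern(1) by simp
    have 3: "d_zbar q z = cnj (cnj (q z) * a0 z + r z * a1 z)"
      using d_zbar_conv_d_z_cnj[OF diff(2)] chern(3) by simp
    \<comment> \<open>Differentiates the relation h(T (1, 0), (1, 0)) = 0, which reflects that the
      Higgs field kills (1, 0).\<close>
    have "d_z (\<lambda>w. p w * t0 w + q w * t1 w) z = 0"
      unfolding adj(1) by (simp add: d_z_def dir_deriv_def)
    then have 4: "d_z p z * t0 z + p z * d_z t0 z + (d_z q z * t1 z + q z * d_z t1 z) = 0"
      by (simp add: d_z_add d_z_mult differentiable_mult diff dt)
    \<comment> \<open>With P the Higgs field, the left side is h(P T (1, 0), (1, 0)); moving P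
      across the metric makes it h(T (1, 0), T (1, 0)).\<close>
    have 5: "e z * t1 z = Q (t0 z) (t1 z) z"
    proof -
      have "e z * t1 z = cnj (t0 z) * (q z * t1 z) + cnj (t1 z) * (r z * t1 z)"
        unfolding e_def adj(3) by (simp add: algebra_simps)
      moreover have "cnj (t1 z) * (cnj (q z) * t0 z) = - (cnj (t0 z) * (p z * t0 z))"
      proof -
        have "p z * cnj (t0 z) = - (cnj (q z) * cnj (t1 z))"
          using arg_cong[OF adj(1)[of z], of cnj] real(1)[of z] by (simp add: eq_neg_iff_add_eq_0)
        then have "p z * cnj (t0 z) * t0 z = - (cnj (q z) * cnj (t1 z)) * t0 z"
          by (rule arg_cong)
        then show ?thesis by (simp add: mult_ac)
      qed
      ultimately show ?thesis
        by (simp add: Q_def algebra_simps)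
    qed
    \<comment> \<open>The first column of the flatness equation is paired with (1, 0). Besides h(P T
      (1, 0), (1, 0)) there remain the derivative of h(T (1, 0), (1, 0)) and multiples of the
      pairings of the columns of T with (1, 0), all of which vanish.\<close>
    have 6: "p z * d_zbar a0 z + q z * d_zbar a1 z = e z * t1 z"
    proof -
      have d: "d_zbar a0 z = d_z t0 z + ((a0 z * t0 z + (b0 z + x) * t1 z) - (t0 z * a0 z + s0 z
          * a1 z))"
        "d_zbar a1 z = d_z t1 z + ((a1 z * t0 z + (b1 z + y) * t1 z) - (t1 z * a0 z + s1 z * a1 z))"
        using curv[of z] by (simp_all add: algebra_simps)
      have "p z * d_zbar a0 z + q z * d_zbar a1 z
          = (d_z p z * t0 z + p z * d_z t0 z + (d_z q z * t1 z + q z * d_z t1 z)) + e z * t1 z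
            - a0 z * (p z * t0 z + q z * t1 z) - a1 z * (p z * s0 z + q z * s1 z)"
        unfolding d chern(1,2) e_def by (simp add: algebra_simps)
      then show ?thesis by (simp only: 4 adj) simp
    qed
    show ?thesis
      using 6 unfolding 1 2 3 5[symmetric] Q_def[of "a0 z"] 
      by (simp add: real algebra_simps)
  qed
  \<comment> \<open>The Bochner identity makes the (0,1)-derivative of \<open>d_z p\<close> real and
    nonnegative, so the integration lemma applies with \<open>d_z p\<close> as \<phi>.\<close>
  have "d_zbar (d_z p) z = 0"
  proof (rule periodic_d_zbar_nonneg_imp_zero[OF L periodic_on_d_z[OF per diff(1)] dd(1)])
    show "continuous_on UNIV (d_z (d_z p))" "continuous_on UNIV (d_zbar (d_z p))"
      using smooth(1) by (simp_all add: Cinf_on_UNIV_continuous Cinf_on_d_z Cinf_on_d_zbar)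
    show "d_zbar (d_z p) z \<in> \<real>" "0 \<le> Re (d_zbar (d_z p) z)" for z
      unfolding main using Q_real Q_nonneg by (simp_all add: Reals_add)
  qed
  \<comment> \<open>Two nonnegative real parts add up to 0, so that of the squared norm of (t0, t1)
    vanishes.\<close>
  then have "Re (Q (t0 z) (t1 z) z) = 0"
    using Q_nonneg[of "a0 z" "a1 z" z] Q_nonneg[of "t0 z" "t1 z" z] 
    unfolding main by (simp add: complex_eq_iff)
  then have "t0 z = 0" "t1 z = 0"
    using pos[of "t0 z" "t1 z" z] by (auto simp: Q_def)
  then show ?thesis using adj(3) by simp
qed

section \<open>Entrywise form of the equations for 2 by 2 matrices\<close>

lemma mat_adjoint_carrier: "A \<in> carrier_mat m n \<Longrightarrow> mat_adjoint A \<in> carrier_mat n m"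
  by (auto simp: mat_adjoint_def)

lemma mat_adjoint_index:
  "i < dim_col A \<Longrightarrow> j < dim_row A \<Longrightarrow> mat_adjoint A $$ (i, j) = cnj (A $$ (j, i))"
  by (simp add: mat_adjoint_def mat_of_rows_def)

lemma mult_mat_2_index:
  assumes "A \<in> carrier_mat 2 2" "B \<in> carrier_mat 2 2" "i < 2" "j < 2"
  shows "(A * B) $$ (i, j) = A $$ (i, 0) * B $$ (0, j) + A $$ (i, 1) * B $$ (1, j)"
  using assms by (simp add: scalar_prod_def numeral_2_eq_2)

lemma pos_def_hermitian_2:
  assumes "pos_def_hermitian 2 H"
  shows "H $$ (1, 0) = cnj (H $$ (0, 1))" "cnj (H $$ (0, 0)) = H $$ (0, 0)" "cnj (H $$ (1, 1))
      = H $$ (1, 1)"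
    and "\<xi> \<noteq> 0 \<or> \<eta> \<noteq> 0 \<Longrightarrow> 0 < Re (cnj \<xi> * (H $$ (0, 0) * \<xi> + H $$ (0, 1) * \<eta>)
       + cnj \<eta> * (cnj (H $$ (0, 1)) * \<xi> + H $$ (1, 1) * \<eta>))"
proof -
  have H: "H \<in> carrier_mat 2 2" and adj: "mat_adjoint H = H" using assms
      by (auto simp: pos_def_hermitian_def)
  have sym: "H $$ (i, j) = cnj (H $$ (j, i))" if "i < 2" "j < 2" for i j
    using mat_adjoint_index[of i H j] that H unfolding adj by auto
  show s: "H $$ (1, 0) = cnj (H $$ (0, 1))" by (rule sym) simp_all
  show "cnj (H $$ (0, 0)) = H $$ (0, 0)" "cnj (H $$ (1, 1)) = H $$ (1, 1)"
    by (rule sym[symmetric]; simp)+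
  assume nz: "\<xi> \<noteq> 0 \<or> \<eta> \<noteq> 0"
  define v where "v = Matrix.vec 2 (\<lambda>i. if i = 0 then \<xi> else \<eta>)"
  have v: "v \<in> carrier_vec 2" "vec_index v 0 = \<xi>" "vec_index v 1 = \<eta>" by (auto simp: v_def)
  with nz have "v \<noteq> 0\<^sub>v 2" by auto
  with v assms have "0 < Re ((H *\<^sub>v v) \<bullet>c v)" by (simp add: pos_def_hermitian_def)
  then show "0 < Re (cnj \<xi> * (H $$ (0, 0) * \<xi> + H $$ (0, 1) * \<eta>)
       + cnj \<eta> * (cnj (H $$ (0, 1)) * \<xi> + H $$ (1, 1) * \<eta>))"
    using H v s by (simp add: scalar_prod_def numeral_2_eq_2 mult_ac)
qed

text \<open>The assumption on \<open>u\<close> keeps the single chart: over other parameters the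
  slice has no charts.\<close>

lemma slice_trivial_family:
  "u \<in> U \<Longrightarrow> slice u (trivial_family U n \<Theta>) =
     \<lparr>bcharts = {0}, bdom = (\<lambda>_. UNIV), brank = n,
      btrans = (\<lambda>_ _ _. 1\<^sub>m n), bdbar = (\<lambda>_ _. 0\<^sub>m n n), bphi = (\<lambda>_. \<Theta> u)\<rparr>"
  by (simp add: slice_def trivial_family_def)

text \<open>The first basis vector lies in the kernel of the Higgs field and (x, y) spans its image,
  so this is the orthogonality of the two that flatness forces.\<close>

lemma harmonic_metric_kernel_orthogonal:
  assumes L: "is_lattice L" and u: "u \<in> U"
    and \<Theta>: "\<Theta> u = (\<lambda>_. mat_of_rows_list 2 [[0, x], [0, y]])"
    and harm: "harmonic_metric L (slice u (trivial_family U 2 \<Theta>)) H"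
  shows "H 0 z $$ (0, 0) * x + H 0 z $$ (0, 1) * y = 0"
proof -
  define P :: "complex mat" where "P = mat_of_rows_list 2 [[0, x], [0, y]]"
  have P: "P \<in> carrier_mat 2 2" "P $$ (0, 0) = 0" "P $$ (0, 1) = x" "P $$ (1, 0) = 0"
      "P $$ (1, 1) = y"
    by (auto simp: P_def mat_of_rows_list_def)
  define K where "K = H 0"
  have smooth: "smooth_mat L UNIV 2 2 K" and pd: "\<And>z. pos_def_hermitian 2 (K z)"
  proof -
    have "hermitian_metric L (slice u (trivial_family U 2 \<Theta>)) H"
      using harm unfolding harmonic_metric_def by blast
    then show "smooth_mat L UNIV 2 2 K" "pos_def_hermitian 2 (K z)" for z
      unfolding hermitian_metric_def slice_trivial_family[OF u] K_def higgs.simps by blast+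
  qed
  have K: "K z \<in> carrier_mat 2 2" for z using pd unfolding pos_def_hermitian_def by blast
  obtain A T where ch: "chern_10 2 UNIV (\<lambda>_. 0\<^sub>m 2 2) K A" and ha: "higgs_adjoint 2 UNIV
      (\<lambda>_. P) K T"
    and cu: "\<And>z. curvature (\<lambda>w. A w + P) (\<lambda>w. 0\<^sub>m 2 2 + T w) z = 0\<^sub>m 2 2"
  proof -
    have "\<exists>A T. chern_10 2 UNIV (\<lambda>_. 0\<^sub>m 2 2) K A \<and> higgs_adjoint 2 UNIV (\<lambda>_. P) K T \<and>
        (\<forall>z. curvature (\<lambda>w. A w + P) (\<lambda>w. 0\<^sub>m 2 2 + T w) z = 0\<^sub>m 2 2)"
      using harm unfolding harmonic_metric_def slice_trivial_family[OF u] \<Theta> K_def P_def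
          higgs.simps by blast
    then show ?thesis using that by blast
  qed
  have A: "A z \<in> carrier_mat 2 2" and T: "T z \<in> carrier_mat 2 2" for z
    using ch ha by (auto simp: chern_10_def higgs_adjoint_def)
  note mult = mult_mat_2_index
  have adj0: "mat_adjoint (0\<^sub>m 2 2 :: complex mat) = 0\<^sub>m 2 2"
    by (intro eq_matI) (auto simp: mat_adjoint_def mat_of_rows_def)
  have chern: "d_z (\<lambda>w. K w $$ (i, j)) z = K z $$ (i, 0) * A z $$ (0, j) + K z $$ (i, 1) * A z
      $$ (1, j)"
    if ij: "i < 2" "j < 2" for i j z
  proof -
    have "mat_d_z K z = K z * A z"
      using ch K[of z] A[of z] by (simp add: chern_10_def adj0)
    then have "mat_d_z K z $$ (i, j) = (K z * A z) $$ (i, j)" by simp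
    also have "mat_d_z K z $$ (i, j) = d_z (\<lambda>w. K w $$ (i, j)) z"
      using ij K[of z] by (simp add: mat_d_z_def)
    finally show ?thesis unfolding mult[OF K A ij] .
  qed
  have adj: "K z $$ (i, 0) * P $$ (0, j) + K z $$ (i, 1) * P $$ (1, j)
      = cnj (T z $$ (0, i)) * K z $$ (0, j) + cnj (T z $$ (1, i)) * K z $$ (1, j)"
    if ij: "i < 2" "j < 2" for i j z
  proof -
    have "(K z * P) $$ (i, j) = (mat_adjoint (T z) * K z) $$ (i, j)"
      using ha by (simp add: higgs_adjoint_def)
    moreover have "mat_adjoint (T z) $$ (i, k) = cnj (T z $$ (k, i))" if "k < 2" for k
      using that ij T[of z] by (auto intro!: mat_adjoint_index)
    ultimately show ?thesis
      unfolding mult[OF K P(1) ij] mult[OF mat_adjoint_carrier[OF T] K ij] by simp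
  qed
  have T0: "(\<lambda>w. 0\<^sub>m 2 2 + T w) = T" using T by auto
  \<comment> \<open>Column 0 of the curvature is the one that enters the Bochner argument. The Higgs
    field contributes nothing to column 0 of \<open>A w + P\<close>, because its own column 0 is
    zero.\<close>
  have curv: "d_z (\<lambda>w. T w $$ (i, 0)) z - d_zbar (\<lambda>w. A w $$ (i, 0)) z
      + ((A z $$ (i, 0) * T z $$ (0, 0) + (A z $$ (i, 1) + P $$ (i, 1)) * T z $$ (1, 0))
       - (T z $$ (i, 0) * A z $$ (0, 0) + T z $$ (i, 1) * A z $$ (1, 0))) = 0"
    if i: "i < 2" for i z
  proof -
    have AP: "A w + P \<in> carrier_mat 2 2" for w using A P by simp
    have AP0: "(A w + P) $$ (i, 0) = A w $$ (i, 0)" if "i < 2" for w i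
      using A[of w] P that by (auto simp: less_2_cases_iff)
    have AP1: "(A w + P) $$ (i, 1) = A w $$ (i, 1) + P $$ (i, 1)" for w
      using A[of w] P i by simp
    have "curvature (\<lambda>w. A w + P) T z $$ (i, 0) = 0" using cu[of z] i unfolding T0 by simp
    moreover have "curvature (\<lambda>w. A w + P) T z $$ (i, 0)
        = mat_d_z T z $$ (i, 0) - mat_d_zbar (\<lambda>w. A w + P) z $$ (i, 0)
          + (((A z + P) * T z) $$ (i, 0) - (T z * (A z + P)) $$ (i, 0))"
      unfolding curvature_def using i A[of z] T[of z] P(1) by (simp add: mat_d_z_def mat_d_zbar_def)
    moreover have "mat_d_z T z $$ (i, 0) = d_z (\<lambda>w. T w $$ (i, 0)) z"
      "mat_d_zbar (\<lambda>w. A w + P) z $$ (i, 0) = d_zbar (\<lambda>w. A w $$ (i, 0)) z"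
      using i T[of z] by (simp_all add: mat_d_z_def mat_d_zbar_def carrier_matD[OF AP] AP0 del:
          index_add_mat)
    ultimately show ?thesis
      using i by (simp add: mult[OF AP T] mult[OF T AP] AP0 AP1[unfolded One_nat_def] del:
          index_add_mat)
  qed
  have K10: "K w $$ (1, 0) = cnj (K w $$ (0, 1))" for w using pos_def_hermitian_2(1)[OF pd] .
  have C: "Cinf_on UNIV (\<lambda>z. K z $$ (i, j))" if "i < 2" "j < 2" for i j
    using smooth that by (simp add: smooth_mat_def)
  have "K z $$ (0, 0) * x + K z $$ (0, 1) * y = 0"
  proof (rule flat_rank_2_kernel_orthogonal[OF L, where z = z
        and p = "\<lambda>z. K z $$ (0, 0)" and q = "\<lambda>z. K z $$ (0, 1)" and r = "\<lambda>z. K z $$ (1, 1)"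
        and ?a0.0 = "\<lambda>z. A z $$ (0, 0)" and ?a1.0 = "\<lambda>z. A z $$ (1, 0)"
        and ?b0.0 = "\<lambda>z. A z $$ (0, 1)" and ?b1.0 = "\<lambda>z. A z $$ (1, 1)"
        and ?t0.0 = "\<lambda>z. T z $$ (0, 0)" and ?t1.0 = "\<lambda>z. T z $$ (1, 0)"
        and ?s0.0 = "\<lambda>z. T z $$ (0, 1)" and ?s1.0 = "\<lambda>z. T z $$ (1, 1)"])
    show "Cinf_on UNIV (\<lambda>z. K z $$ (0, 0))" "Cinf_on UNIV (\<lambda>z. K z $$ (0, 1))"
      "Cinf_on UNIV (\<lambda>z. cnj (K z $$ (0, 1)))" "Cinf_on UNIV (\<lambda>z. K z $$ (1, 1))"
      using C[of 0 0] C[of 0 1] C[of 1 0] C[of 1 1] by (simp_all add: K10[unfolded One_nat_def])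
    show "periodic_on L UNIV (\<lambda>z. K z $$ (0, 0))"
      using smooth by (auto simp: smooth_mat_def periodic_on_def)
    fix z
    show "cnj (K z $$ (0, 0)) = K z $$ (0, 0)" "cnj (K z $$ (1, 1)) = K z $$ (1, 1)"
      by (rule pos_def_hermitian_2[OF pd])+
    show "0 < Re (cnj \<xi> * (K z $$ (0, 0) * \<xi> + K z $$ (0, 1) * \<eta>)
       + cnj \<eta> * (cnj (K z $$ (0, 1)) * \<xi> + K z $$ (1, 1) * \<eta>))" if "\<xi> \<noteq> 0 \<or> \<eta> \<noteq> 0" for \<xi> \<eta>
      using pos_def_hermitian_2(4)[OF pd that] .
    show "d_z (\<lambda>z. K z $$ (0, 0)) z = K z $$ (0, 0) * A z $$ (0, 0) + K z $$ (0, 1) * A z $$ (1, 0)"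
      "d_z (\<lambda>z. K z $$ (0, 1)) z = K z $$ (0, 0) * A z $$ (0, 1) + K z $$ (0, 1) * A z $$ (1, 1)"
      "d_z (\<lambda>w. cnj (K w $$ (0, 1))) z = cnj (K z $$ (0, 1)) * A z $$ (0, 0) + K z $$ (1, 1) * A
          z $$ (1, 0)"
      using chern[of 0 0 z] chern[of 0 1 z] chern[of 1 0 z]
          by (simp_all add: K10[unfolded One_nat_def])
    \<comment> \<open>Column 0 of \<open>P\<close> is zero, so the conjugated adjointness equation
      makes this column of \<open>T z\<close>, and next the other one, orthogonal to (1, 0).\<close>
    show "K z $$ (0, 0) * T z $$ (0, 0) + K z $$ (0, 1) * T z $$ (1, 0) = 0"
      using arg_cong[OF adj[of 0 0 z], of cnj] pos_def_hermitian_2(2)[OF pd, of z]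
      by (simp add: P[unfolded One_nat_def] K10[unfolded One_nat_def] mult.commute)
    show "K z $$ (0, 0) * T z $$ (0, 1) + K z $$ (0, 1) * T z $$ (1, 1) = 0"
      using arg_cong[OF adj[of 1 0 z], of cnj] pos_def_hermitian_2(2)[OF pd, of z]
      by (simp add: P[unfolded One_nat_def] K10[unfolded One_nat_def] mult.commute)
    show "K z $$ (0, 0) * x + K z $$ (0, 1) * y = cnj (T z $$ (0, 0)) * K z $$ (0, 1) + cnj (T z
        $$ (1, 0)) * K z $$ (1, 1)"
      using adj[of 0 1 z] by (simp add: P[unfolded One_nat_def])
  qed (use curv[of 0] curv[of 1] in \<open>simp_all add: P[unfolded One_nat_def]\<close>)
  then show ?thesis by (simp add: K_def)
qed

section \<open>Families constant along the curve\<close>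

lemma iter_deriv_const: "\<exists>c'. iter_deriv vs (\<lambda>_. c) = (\<lambda>_. c')"
proof (induction vs)
  case (Cons v vs)
  then obtain c' where "iter_deriv vs (\<lambda>_. c) = (\<lambda>_. c')" by blast
  then have "iter_deriv (v # vs) (\<lambda>_. c) = (\<lambda>_. 0)"
    by (auto simp: iter_deriv_def dir_deriv_def)
  then show ?case by blast
qed (auto simp: iter_deriv_def)

lemma iter_deriv_Cons_const: "iter_deriv (v # vs) (\<lambda>_. c) = (\<lambda>_. 0)"
proof -
  obtain c' where "iter_deriv vs (\<lambda>_. c) = (\<lambda>_. c')" using iter_deriv_const by blast
  then show ?thesis
    by (auto simp: iter_deriv_def dir_deriv_def)
qed

lemma Cinf_on_const: "Cinf_on W (\<lambda>_. c)"
  unfolding Cinf_on_def using iter_deriv_const[of _ c] by (metis differentiable_on_const)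

text \<open>Only the empty list of directions carries content: every proper derivative of a function
  constant along the curve is 0.\<close>

lemma Cinf_tendsto_const:
  assumes "(c \<longlongrightarrow> l) F"
  shows "Cinf_tendsto W (\<lambda>u _. c u) (\<lambda>_. l) F"
  unfolding Cinf_tendsto_def
proof (intro allI impI)
  fix vs :: "complex list" and K :: "complex set"
  show "uniform_limit K (\<lambda>u. iter_deriv vs (\<lambda>_. c u)) (iter_deriv vs (\<lambda>_. l)) F"
  proof (cases vs)
    case Nil
    have "\<forall>\<^sub>F u in F. dist (c u) l < e" if "e > 0" for e
      using assms that by (rule tendstoD)
    then show ?thesis using Nil
      by (auto simp: iter_deriv_def uniform_limit_iff elim!: eventually_mono)
  qed (auto simp: iter_deriv_Cons_const uniform_limit_iff)
qed

text \<open>The k-th parameter derivative is the k-th formal derivative of the polynomial, so a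
  single witness serves for all \<open>d\<close>, including infinity.\<close>

lemma mixed_reg_poly:
  fixes p :: "complex poly"
  assumes "\<And>u z. u \<in> V \<Longrightarrow> f u z = poly p (of_real u)"
  shows "mixed_reg d V W f"
proof -
  define g where "g k u = poly ((pderiv ^^ k) p) (of_real u)" for k and u :: real
  have quot: "((\<lambda>s. (g k s - g k u) / (of_real s - of_real u)) \<longlongrightarrow> g (Suc k) u) (at u)" for k u
  proof -
    have "((\<lambda>z. (poly q z - poly q (of_real u)) / (z - of_real u)) \<longlongrightarrow> poly (pderiv q) (of_real u))
        (at (of_real u))" for q :: "complex poly"
      using poly_DERIV[of q "of_real u"] by (simp add: has_field_derivative_iff)
    moreover have "filterlim complex_of_real (at (of_real u)) (at u)"
      by (auto simp: filterlim_at eventually_at_filter intro!: tendsto_intros)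
    ultimately show ?thesis
      unfolding g_def funpow.simps comp_def by (rule filterlim_compose)
  qed
  have cont: "(g k \<longlongrightarrow> g k u) (at u)" for k u
    unfolding g_def by (intro tendsto_intros)
  show ?thesis
    unfolding mixed_reg_def
    by (rule exI[of _ "\<lambda>k u _. g k u"])
      (use assms in \<open>auto simp: Cinf_on_const g_def[of 0] intro!: Cinf_tendsto_const cont quot\<close>)
qed

text \<open>The polynomial is chosen before the parameter and the point, which encodes coefficients
  that are constant along the curve and smooth in the parameter.\<close>

definition poly_mat :: "nat \<Rightarrow> nat \<Rightarrow> (real \<Rightarrow> complex \<Rightarrow> complex mat) \<Rightarrow> bool" where
  "poly_mat m n M \<longleftrightarrow> (\<forall>u z. M u z \<in> carrier_mat m n) \<and>
     (\<forall>i<m. \<forall>j<n. \<exists>p. \<forall>u z. M u z $$ (i, j) = poly p (of_real u))"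

lemma poly_mat_const: "A \<in> carrier_mat m n \<Longrightarrow> poly_mat m n (\<lambda>_ _. A)"
  unfolding poly_mat_def by (auto intro!: exI[of _ "[:A $$ _:]"])

lemma poly_mat_indep:
  assumes "poly_mat m n M" shows "M u z = M u w"
  using assms unfolding poly_mat_def by (intro eq_matI; clarsimp) (metis carrier_matD)+

lemma smooth_mat_const: "A \<in> carrier_mat m n \<Longrightarrow> smooth_mat L W m n (\<lambda>_. A)"
  by (simp add: smooth_mat_def periodic_on_def Cinf_on_const)

lemma d_z_const [simp]: "d_z (\<lambda>_. c) z = 0" and d_zbar_const [simp]: "d_zbar (\<lambda>_. c) z = 0"
  by (simp_all add: d_z_def d_zbar_def dir_deriv_def)

lemma mat_d_z_const: "A \<in> carrier_mat m n \<Longrightarrow> mat_d_z (\<lambda>_. A) z = 0\<^sub>m m n"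
  and mat_d_zbar_const: "A \<in> carrier_mat m n \<Longrightarrow> mat_d_zbar (\<lambda>_. A) z = 0\<^sub>m m n"
  by (auto simp: mat_d_z_def mat_d_zbar_def)

lemma poly_mat_slice:
  assumes "poly_mat m n M"
  obtains A where "A \<in> carrier_mat m n" "M u = (\<lambda>_. A)"
proof
  show "M u = (\<lambda>_. M u 0)" using poly_mat_indep[OF assms] by blast
  show "M u 0 \<in> carrier_mat m n" using assms by (simp add: poly_mat_def)
qed

lemma mixed_mat_poly:
  assumes "poly_mat m n M"
  shows "mixed_mat d V W (\<lambda>_. m) (\<lambda>_. n) M"
  unfolding mixed_mat_def
proof (intro allI)
  fix i j
  show "mixed_reg d {u \<in> V. i < m \<and> j < n} W (\<lambda>u z. M u z $$ (i, j))"
  proof (cases "i < m \<and> j < n")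
    case True
    then obtain p where "\<And>u z. M u z $$ (i, j) = poly p (of_real u)"
      using assms unfolding poly_mat_def by metis
    then show ?thesis by (intro mixed_reg_poly)
  \<comment> \<open>For indices out of range the parameter set is empty and regularity is
    vacuous.\<close>
  qed (auto intro: mixed_reg_poly)
qed

lemma higgs_bundle_slice:
  assumes "poly_mat n n \<Theta>" "u \<in> U"
  shows "higgs_bundle L (slice u (trivial_family U n \<Theta>))"
proof -
  obtain A where "A \<in> carrier_mat n n" "\<Theta> u = (\<lambda>_. A)" by (rule poly_mat_slice[OF assms(1)])
  then show ?thesis
    using assms(2)
    by (simp add: higgs_bundle_def slice_trivial_family torus_open_def smooth_mat_const
        mat_d_zbar_const[of _ n n])
qed

lemma higgs_family_trivial:
  assumes "poly_mat n n \<Theta>" "open U"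
  shows "higgs_family L d U (trivial_family U n \<Theta>)"
  using assms higgs_bundle_slice[OF assms(1)]
  by (auto simp: higgs_family_def trivial_family_def intro!: mixed_mat_poly poly_mat_const)

lemma higgs_morphism_slice:
  assumes "A \<in> carrier_mat m n" "u \<in> U" "\<And>z. \<Theta>' u z * A = A * \<Theta> u z"
  shows "higgs_morphism L (slice u (trivial_family U n \<Theta>)) (slice u (trivial_family U m \<Theta>'))
      (\<lambda>_ _ _. A)"
  using assms
  by (simp add: higgs_morphism_def slice_trivial_family smooth_mat_const mat_d_zbar_const[of _ m n])

lemma family_morphism_trivial:
  assumes "A \<in> carrier_mat m n" "\<And>u z. u \<in> U \<Longrightarrow> \<Theta>' u z * A = A * \<Theta> u z"
  shows "family_morphism L d U (trivial_family U n \<Theta>) (trivial_family U m \<Theta>') (\<lambda>_ _ _ _. A)"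
  unfolding family_morphism_def
  using higgs_morphism_slice[OF assms(1)] assms
  by (auto simp: trivial_family_def intro!: mixed_mat_poly poly_mat_const)

lemma family_injective_trivial:
  assumes "mat_ker A = {0\<^sub>v n}"
  shows "family_injective U (trivial_family U n \<Theta>) (trivial_family U m \<Theta>') (\<lambda>_ _ _ _. A)"
  using assms by (simp add: family_injective_def fibre_injective_def slice_trivial_family)

lemma family_surjective_trivial:
  assumes "mat_range A = carrier_vec m"
  shows "family_surjective U (trivial_family U n \<Theta>) (trivial_family U m \<Theta>') (\<lambda>_ _ _ _. A)"
  using assms by (simp add: family_surjective_def fibre_surjective_def slice_trivial_family)

lemma mat_ker_one: "mat_ker (1\<^sub>m n) = {0\<^sub>v n}"
  by (auto simp: mat_ker_def)

lemma mat_range_one: "mat_range (1\<^sub>m n) = carrier_vec n"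
  by (auto simp: mat_range_def) (metis one_mult_mat_vec)

section \<open>Standard metric, degree and stability\<close>

lemma hermitian_metric_one:
  assumes "u \<in> U"
  shows "hermitian_metric L (slice u (trivial_family U n \<Theta>)) (\<lambda>_ _. 1\<^sub>m n)"
proof -
  have *: "mat_adjoint (1\<^sub>m n :: complex mat) = 1\<^sub>m n"
    by (intro eq_matI) (auto simp: mat_adjoint_def mat_of_rows_def)
  have "0 < Re (v \<bullet>c v)" if "v \<in> carrier_vec n" "v \<noteq> 0\<^sub>v n" for v :: "complex vec"
    using conjugate_square_greater_0_vec[of v n] that by (simp add: less_complex_def)
  with * show ?thesis
    using assms
    by (simp add: hermitian_metric_def slice_trivial_family smooth_mat_const pos_def_hermitian_def)
qed

text \<open>1 by 1 matrices commute, so the commutator of the Higgs field with its adjoint vanishes;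
  the derivative terms vanish because all coefficients are constant along the curve.\<close>

lemma harmonic_metric_one_rank_1:
  assumes "poly_mat 1 1 \<Theta>" "u \<in> U"
  shows "harmonic_metric L (slice u (trivial_family U 1 \<Theta>)) (\<lambda>_ _. 1\<^sub>m 1)"
proof -
  obtain A where A: "A \<in> carrier_mat 1 1" "\<Theta> u = (\<lambda>_. A)" by (rule poly_mat_slice[OF assms(1)])
  define T where "T = mat_adjoint A"
  have T: "T \<in> carrier_mat 1 1" "mat_adjoint T = A"
    using A by (auto simp: T_def mat_adjoint_def mat_of_rows_def intro!: eq_matI)
  have comm: "A * T = T * A"
    using A(1) T(1) by (auto intro!: eq_matI simp: scalar_prod_def)
  have adj0: "mat_adjoint (0\<^sub>m 1 1 :: complex mat) = 0\<^sub>m 1 1"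
    by (intro eq_matI) (auto simp: mat_adjoint_def mat_of_rows_def)
  show ?thesis
    unfolding harmonic_metric_def
  proof (intro conjI ballI, goal_cases)
    case 1
    show ?case
      using hermitian_metric_one[OF assms(2)] .
  next
    case (2 c)
    show ?case
      by (rule exI[of _ "\<lambda>_. 0\<^sub>m 1 1"], rule exI[of _ "\<lambda>_. T"])
        (use assms(2) A T comm adj0 in
          \<open>auto simp: slice_trivial_family chern_10_def higgs_adjoint_def curvature_def
            mat_d_z_const[of _ 1 1] mat_d_zbar_const[of _ 1 1]\<close>)
  qed
qed

lemma harmonic_metric_family_one_rank_1:
  assumes "poly_mat 1 1 \<Theta>"
  shows "harmonic_metric_family L d U (trivial_family U 1 \<Theta>) (\<lambda>_ _ _. 1\<^sub>m 1)"
  using harmonic_metric_one_rank_1[OF assms]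
  by (auto simp: harmonic_metric_family_def trivial_family_def intro!: mixed_mat_poly
      poly_mat_const)

text \<open>The standard metric has zero Chern curvature, so the integrand defining the degree is
  0.\<close>

lemma has_degree_slice:
  assumes "is_lattice L" "u \<in> U"
  shows "has_degree L (slice u (trivial_family U n \<Theta>)) 0"
proof -
  obtain w1 w2 where w: "is_lattice_basis L w1 w2" using assms by (auto simp: is_lattice_def)
  have adj0: "mat_adjoint (0\<^sub>m n n :: complex mat) = 0\<^sub>m n n"
    by (intro eq_matI) (auto simp: mat_adjoint_def mat_of_rows_def)
  show ?thesis
    unfolding has_degree_def
    by (rule exI[of _ "\<lambda>_ _. 1\<^sub>m n"], rule exI[of _ "\<lambda>_ _. 0\<^sub>m n n"], rule exI[of _ "\<lambda>_. 0"],
        rule exI[of _ w1], rule exI[of _ w2])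
      (use w hermitian_metric_one[OF assms(2)] adj0 assms(2) in
        \<open>auto simp: slice_trivial_family chern_10_def curvature_def
          mat_d_z_const[of _ n n] mat_d_zbar_const[of _ n n]\<close>)
qed

text \<open>No rank lies strictly between 0 and 1, so the slope inequality is vacuous.\<close>

lemma stable_rank_1:
  assumes "poly_mat 1 1 \<Theta>" "u \<in> U"
  shows "stable L (slice u (trivial_family U 1 \<Theta>))"
  using higgs_bundle_slice[OF assms] assms(2) by (auto simp: stable_def slice_trivial_family)

section \<open>Extensions of rank 1 families\<close>

lemma embedded_subfamily_trivial:
  assumes "A \<in> carrier_mat m n" "mat_ker A = {0\<^sub>v n}" "poly_mat n n \<Theta>" "open U"
    and "\<And>u z. u \<in> U \<Longrightarrow> \<Theta>' u z * A = A * \<Theta> u z"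
  shows "embedded_subfamily L d U (trivial_family U m \<Theta>') (\<lambda>_ _ _. mat_range A)
     (trivial_family U n \<Theta>) (\<lambda>_ _ _ _. A)"
  unfolding embedded_subfamily_def
  using assms higgs_family_trivial family_morphism_trivial family_injective_trivial by auto

lemma restrict_family_trivial: "restrict_family U (trivial_family U n \<Theta>) = trivial_family U n \<Theta>"
  by (simp add: restrict_family_def trivial_family_def)

section \<open>Matrices for lines, quotients and triangular Higgs fields\<close>

definition col2 :: "complex \<Rightarrow> complex \<Rightarrow> complex mat" where
  "col2 b d = Matrix.mat 2 1 (\<lambda>(i, j). if i = 0 then b else d)"

definition higgs2 :: "complex \<Rightarrow> complex \<Rightarrow> complex mat" where
  "higgs2 x y = mat_of_rows_list 2 [[0, x], [0, y]]"

definition scalar1 :: "complex \<Rightarrow> complex mat" where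
  "scalar1 c = Matrix.mat 1 1 (\<lambda>_. c)"

definition proj2 :: "complex mat" where
  "proj2 = Matrix.mat 1 2 (\<lambda>(i, j). if j = 0 then 0 else 1)"

lemma example_mat_carriers:
  "col2 b d \<in> carrier_mat 2 1" "higgs2 x y \<in> carrier_mat 2 2" "scalar1 c \<in> carrier_mat 1 1"
      "proj2 \<in> carrier_mat 1 2"
  by (auto simp: col2_def higgs2_def scalar1_def proj2_def mat_of_rows_list_def)

declare example_mat_carriers[unfolded One_nat_def, simp]
  and example_mat_carriers[THEN carrier_matD(1), simp] example_mat_carriers[THEN
      carrier_matD(2), simp]

text \<open>Together with \<open>col2_scalar1\<close> it turns the eigenvector condition on (b, d)
  into an intertwining relation for the inclusion of a line.\<close>

lemma higgs2_col2: "higgs2 x y * col2 b d = col2 (x * d) (y * d)"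
  by (rule eq_matI)
    (auto simp: col2_def higgs2_def mat_of_rows_list_def scalar_prod_def numeral_2_eq_2 less_Suc_eq)

lemma col2_scalar1: "col2 b d * scalar1 c = col2 (b * c) (d * c)"
  by (rule eq_matI) (auto simp: col2_def scalar1_def scalar_prod_def)

text \<open>The triangular shape lets the Higgs field descend to the second coordinate, where it
  acts by \<open>y\<close>.\<close>

lemma proj2_higgs2: "scalar1 y * proj2 = proj2 * higgs2 x y"
  by (rule eq_matI)
    (auto simp: proj2_def scalar1_def higgs2_def mat_of_rows_list_def scalar_prod_def
        numeral_2_eq_2 less_Suc_eq)

lemma col2_mult_vec_index:
  "v \<in> carrier_vec 1 \<Longrightarrow> i < 2 \<Longrightarrow> vec_index (col2 b d *\<^sub>v v) i = (if i
      = 0 then b else d) * vec_index v 0"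
  by (simp add: col2_def scalar_prod_def)

lemma vec_1_eqI: "v \<in> carrier_vec 1 \<Longrightarrow> w \<in> carrier_vec 1 \<Longrightarrow> vec_index v 0 = vec_index w 0 \<Longrightarrow> v = w"
  by (intro eq_vecI) auto

lemma mat_range_col2: "mat_range (col2 1 0) = {v \<in> carrier_vec 2. vec_index v 1 = 0}"
proof (intro equalityI subsetI)
  fix v assume "v \<in> mat_range (col2 1 0)"
  then obtain w where w: "w \<in> carrier_vec 1" "v = col2 1 0 *\<^sub>v w"
    by (auto simp: mat_range_def)
  then have "v \<in> carrier_vec 2" using mult_mat_vec_carrier[OF example_mat_carriers(1)] by blast
  with w col2_mult_vec_index[OF w(1), of 1 1 0] show "v \<in> {v \<in> carrier_vec 2. vec_index v 1 = 0}"
    by simp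
next
  fix v :: "complex vec" assume v: "v \<in> {v \<in> carrier_vec 2. vec_index v 1 = 0}"
  define w where "w = Matrix.vec 1 (\<lambda>_. vec_index v 0)"
  have w: "w \<in> carrier_vec 1" "vec_index w 0 = vec_index v 0" by (auto simp: w_def)
  have "v = col2 1 0 *\<^sub>v w"
  proof (rule eq_vecI)
    show "dim_vec v = dim_vec (col2 1 0 *\<^sub>v w)" using v by (auto simp: col2_def)
    fix i assume "i < dim_vec (col2 1 0 *\<^sub>v w)"
    then have "i < 2" by (simp add: col2_def)
    then show "vec_index v i = vec_index (col2 1 0 *\<^sub>v w) i"
      using v w by (subst col2_mult_vec_index) (auto simp: less_2_cases_iff)
  qed
  then show "v \<in> mat_range (col2 1 0)"
    using w(1) by (auto simp: mat_range_def)
qed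

lemma mat_ker_col2: "mat_ker (col2 1 0) = {0\<^sub>v 1}"
proof -
  have "v = 0\<^sub>v 1" if v: "v \<in> carrier_vec 1" "col2 1 0 *\<^sub>v v = 0\<^sub>v 2" for v
    using col2_mult_vec_index[OF v(1), of 0 1 0] v by (intro vec_1_eqI) auto
  moreover have "col2 1 0 *\<^sub>v 0\<^sub>v 1 = 0\<^sub>v 2"
    by (intro eq_vecI) (auto simp: col2_def scalar_prod_def)
  ultimately show ?thesis
    by (auto simp: mat_ker_def)
qed

lemma proj2_mult_vec: "v \<in> carrier_vec 2 \<Longrightarrow> proj2 *\<^sub>v v = Matrix.vec 1 (\<lambda>_. vec_index v 1)"
  by (intro eq_vecI) (auto simp: proj2_def scalar_prod_def numeral_2_eq_2)

text \<open>Exactness in the middle for the extension by the line spanned by (1, 0).\<close>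

lemma mat_ker_proj2: "mat_ker proj2 = mat_range (col2 1 0)"
proof -
  have "Matrix.vec 1 (\<lambda>_. c) = 0\<^sub>v 1 \<longleftrightarrow> c = 0" for c :: complex
    by (auto simp: vec_eq_iff)
  then show ?thesis
    unfolding mat_range_col2 mat_ker_def using proj2_mult_vec by auto
qed

lemma mat_range_proj2: "mat_range proj2 = carrier_vec 1"
proof (intro equalityI subsetI)
  fix v :: "complex vec" assume v: "v \<in> carrier_vec 1"
  define w where "w = Matrix.vec 2 (\<lambda>_. vec_index v 0)"
  have w: "w \<in> carrier_vec 2" by (simp add: w_def)
  then have "proj2 *\<^sub>v w = v"
    unfolding proj2_mult_vec[OF w] using v by (intro vec_1_eqI) (auto simp: w_def)
  then show "v \<in> mat_range proj2" using w by (auto simp: mat_range_def)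
qed (use proj2_mult_vec in \<open>auto simp: mat_range_def\<close>)

lemma poly_mat_scalar1: "poly_mat 1 1 (\<lambda>t _. scalar1 (poly p (of_real t)))"
  by (auto simp: poly_mat_def scalar1_def)

lemma poly_mat_higgs2: "poly_mat 2 2 (\<lambda>t _. higgs2 (poly p (of_real t)) (poly q (of_real t)))"
proof -
  have "\<exists>r. \<forall>t. higgs2 (poly p (complex_of_real t)) (poly q (of_real t)) $$ (i, j)
      = poly r (of_real t)"
    if "i < 2" "j < 2" for i j
    using that
    by (intro exI[of _ "if j = 0 then 0 else if i = 0 then p else q"])
      (auto simp: higgs2_def mat_of_rows_list_def less_2_cases_iff)
  then show ?thesis by (simp add: poly_mat_def)
qed

text \<open>The eigenvector e1 is completed to an eigenbasis by the vector (b, d).\<close>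

lemma polystable_rank_2:
  assumes L: "is_lattice L" and t: "t \<in> U" and P: "poly_mat 2 2 \<Theta>" and \<Theta>: "\<And>z. \<Theta> t z = higgs2 x y"
    and eig: "x * d = y * b" "d \<noteq> 0"
  shows "polystable L (slice t (trivial_family U 2 \<Theta>))"
proof -
  \<comment> \<open>Line bundles modelling the two eigenlines, with eigenvalues 0 and
    \<open>y\<close>.\<close>
  define S where "S k = slice t (trivial_family U 1 (\<lambda>_ _. scalar1 (if k = 0 then 0 else y)))"
      for k :: nat
  define M where "M k = (if k = 0 then col2 1 0 else col2 b d)" for k :: nat
  have pm: "poly_mat 1 1 (\<lambda>_ _. scalar1 c)" for c by (intro poly_mat_const example_mat_carriers)
  have S: "bcharts (S k) = {0}" "brank (S k) = 1" for k
    using t by (simp_all add: S_def slice_trivial_family)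
  have mor: "higgs_morphism L (S k) (slice t (trivial_family U 2 \<Theta>)) (\<lambda>_ _ _. M k)" for k
    unfolding S_def
    by (rule higgs_morphism_slice)
      (use t eig in \<open>auto simp: M_def \<Theta> higgs2_col2 col2_scalar1 mult.commute\<close>)
  have ex: "\<exists>!w. w \<in> (\<Pi>\<^sub>E k\<in>{..<2::nat}. carrier_vec 1) \<and>
      (\<forall>i<2. vec_index v i = (\<Sum>k<2. vec_index (M k *\<^sub>v w k) i))" if v: "v \<in> carrier_vec 2"
          for v :: "complex vec"
  proof -
    \<comment> \<open>The decomposition of \<open>v\<close> along (1, 0) and (b, d) is solved from
      the second coordinate upwards, dividing by \<open>d\<close>.\<close>
    have eq: "(\<forall>i<2. vec_index v i = (\<Sum>k<2. vec_index (M k *\<^sub>v w k) i)) \<longleftrightarrow>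
        vec_index (w 0) 0 = vec_index v 0 - b * vec_index v 1 / d \<and> vec_index (w 1) 0
            = vec_index v 1 / d"
      if w: "w \<in> (\<Pi>\<^sub>E k\<in>{..<2::nat}. carrier_vec 1)" for w
    proof -
      have wc: "w 0 \<in> carrier_vec 1" "w (Suc 0) \<in> carrier_vec 1" using w by (auto simp: PiE_iff)
      have "(\<forall>i<2. vec_index v i = (\<Sum>k<2. vec_index (M k *\<^sub>v w k) i)) \<longleftrightarrow>
          vec_index v 0 = vec_index (w 0) 0 + b * vec_index (w 1) 0 \<and> vec_index v 1
              = d * vec_index (w 1) 0"
        using wc by (auto simp: numeral_2_eq_2 less_Suc_eq M_def col2_mult_vec_index simp del:
            index_mult_mat_vec)
      also have "\<dots> \<longleftrightarrow> vec_index (w 0) 0 = vec_index v 0 - b * vec_index v 1 / d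
          \<and> vec_index (w 1) 0 = vec_index v 1 / d"
        using eig(2) by auto
      finally show ?thesis .
    qed
    \<comment> \<open>The restricted abstraction gives the function its default value outside {0,
      1}, as membership in the extensional product, and hence uniqueness, requires.\<close>
    define w0 where "w0 = (\<lambda>k\<in>{..<2::nat}. Matrix.vec 1 (\<lambda>_. if k = 0
      then vec_index v 0 - b * vec_index v 1 / d else vec_index v 1 / d))"
    have w0: "w0 \<in> (\<Pi>\<^sub>E k\<in>{..<2}. carrier_vec 1)" by (auto simp: w0_def)
    have idx: "vec_index (w0 0) 0 = vec_index v 0 - b * vec_index v 1 / d" "vec_index (w0 1) 0
        = vec_index v 1 / d"
      by (simp_all add: w0_def)
    show ?thesis
    proof (rule ex1I[of _ w0], goal_cases)
      case 1
      show ?case using w0 idx by (simp add: eq)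
    next
      case (2 w)
      then have w: "w \<in> (\<Pi>\<^sub>E k\<in>{..<2}. carrier_vec 1)"
        "vec_index (w 0) 0 = vec_index (w0 0) 0" "vec_index (w 1) 0 = vec_index (w0 1) 0"
        using eq idx by auto
      show "w = w0"
      proof (rule PiE_ext[OF w(1) w0])
        fix k :: nat assume k: "k \<in> {..<2}"
        then have "w k \<in> carrier_vec 1" "w0 k \<in> carrier_vec 1" using w(1) w0 by (auto simp: PiE_iff)
        moreover have "vec_index (w k) 0 = vec_index (w0 k) 0"
          using k w by (auto simp: less_2_cases_iff)
        ultimately show "w k = w0 k" by (rule vec_1_eqI)
      qed
    qed
  qed
  let ?E = "slice t (trivial_family U 2 \<Theta>)"
  have deg: "has_degree L (S k) 0" for k unfolding S_def by (rule has_degree_slice[OF L t])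
  have "stable L (S k)" for k unfolding S_def by (rule stable_rank_1[OF pm t])
  moreover have "\<exists>d. has_degree L (S k) d \<and> d / real (brank (S k)) = 0" for k
    by (rule exI[of _ 0]) (simp add: deg)
  ultimately have summands: "\<forall>k<2. stable L (S k) \<and> higgs_morphism L (S k) ?E (\<lambda>_ _ _. M k) \<and>
      (\<exists>d. has_degree L (S k) d \<and> d / real (brank (S k)) = 0)"
    using mor by simp
  have decomposition: "\<forall>c\<in>bcharts ?E. \<forall>z\<in>bdom ?E c. \<forall>e.
      (\<forall>k<2. e k \<in> bcharts (S k) \<and> z \<in> bdom (S k) (e k)) \<longrightarrow>
      (\<forall>v\<in>carrier_vec (brank ?E). \<exists>!w. w \<in> (\<Pi>\<^sub>E k\<in>{..<2}. carrier_vec (brank (S k))) \<and>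
          (\<forall>i<brank ?E. vec_index v i = (\<Sum>k<2. vec_index (M k *\<^sub>v w k) i)))"
    unfolding S(2) slice_trivial_family[OF t] higgs.simps by (intro ballI allI impI ex)
  show ?thesis
    unfolding polystable_def
    by (intro conjI exI[of _ "2::nat"] exI[of _ S] exI[of _ "\<lambda>k _ _ _. M k"] exI[of _ "0::real"]
        higgs_bundle_slice[OF P t] summands decomposition)
qed

text \<open>The middle step is invariant because the first column of the Higgs field is 0; the
  graded pieces are line families with Higgs fields 0 and \<open>y t\<close>.\<close>

lemma relative_harmonic_filtration_rank_2:
  assumes U: "open U" and p: "\<And>t. x t = poly p (of_real t)" and q: "\<And>t. y t = poly q (of_real t)"
  shows "relative_harmonic_filtration L d U (trivial_family U 2 (\<lambda>t _. higgs2 (x t) (y t))) 2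
    (\<lambda>i _ _ _. if i = 0 then {0\<^sub>v 2} else if i = 1 then mat_range (col2 1 0) else carrier_vec 2)"
    (is "relative_harmonic_filtration L d U ?E 2 ?S")
proof -
  have P2: "poly_mat 2 2 (\<lambda>t _. higgs2 (x t) (y t))" unfolding p q by (rule poly_mat_higgs2)
  have P1: "poly_mat 1 1 (\<lambda>t _. scalar1 (y t))" unfolding q by (rule poly_mat_scalar1)
  have P10: "poly_mat 1 1 (\<lambda>t _. scalar1 0)" by (intro poly_mat_const example_mat_carriers)
  have P0: "poly_mat 0 0 (\<lambda>t _. 0\<^sub>m 0 0)" by (rule poly_mat_const) simp
  \<comment> \<open>The zero step must also be the image of an embedded family; a 2 by 0 matrix
    embeds the family of rank 0.\<close>
  define Z :: "complex mat" where "Z = 0\<^sub>m 2 0"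
  have vec0: "v \<in> carrier_vec 0 \<longleftrightarrow> v = 0\<^sub>v 0" for v :: "complex vec" by auto
  have Z: "Z \<in> carrier_mat 2 0" "mat_ker Z = {0\<^sub>v 0}" "mat_range Z = {0\<^sub>v 2}"
    by (auto simp: Z_def mat_ker_def mat_range_def vec0 simp del: carrier_vec_dim_vec)
  have e0: "embedded_subfamily L d U ?E (\<lambda>_ _ _. {0\<^sub>v 2}) (trivial_family U 0 (\<lambda>t _. 0\<^sub>m 0 0))
      (\<lambda>_ _ _ _. Z)"
    using embedded_subfamily_trivial[OF Z(1,2) P0 U] unfolding Z(3)
    by (auto simp: Z_def right_mult_zero_mat[OF example_mat_carriers(2)])
  have e1: "embedded_subfamily L d U ?E (\<lambda>_ _ _. mat_range (col2 1 0)) (trivial_family U 1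
      (\<lambda>t _. scalar1 0)) (\<lambda>_ _ _ _. col2 1 0)"
    by (rule embedded_subfamily_trivial[OF example_mat_carriers(1) mat_ker_col2 P10 U])
      (simp add: higgs2_col2 col2_scalar1)
  have e2: "embedded_subfamily L d U ?E (\<lambda>_ _ _. carrier_vec 2) ?E (\<lambda>_ _ _ _. 1\<^sub>m 2)"
    using embedded_subfamily_trivial[OF one_carrier_mat mat_ker_one P2 U, of
        "\<lambda>t _. higgs2 (x t) (y t)"]
    unfolding mat_range_one by (simp add: right_mult_one_mat[OF example_mat_carriers(2)]
        left_mult_one_mat[OF example_mat_carriers(2)])
  have inv: "invariant_subbundle L d U ?E (?S i)" for i
    unfolding invariant_subbundle_def using e0 e1 e2 by (cases "i = 0"; cases "i = 1") auto
  have chain: "{0\<^sub>v 2} \<subseteq> mat_range (col2 1 0)" "mat_range (col2 1 0) \<subseteq> carrier_vec 2"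
    unfolding mat_range_col2 by auto
  \<comment> \<open>The lowest quotient is the line itself, with the identity as projection.\<close>
  have q0: "subquotient L d U ?E (\<lambda>_ _ _. mat_range (col2 1 0)) (\<lambda>_ _ _. {0\<^sub>v 2})
      (trivial_family U 1 (\<lambda>t _. scalar1 0))"
  proof -
    have "family_morphism L d U (trivial_family U 1 (\<lambda>t _. scalar1 0)) (trivial_family U 1
        (\<lambda>t _. scalar1 0)) (\<lambda>_ _ _ _. 1\<^sub>m 1)"
      by (rule family_morphism_trivial) auto
    moreover have "family_surjective U (trivial_family U 1 (\<lambda>t _. scalar1 0))
        (trivial_family U 1 (\<lambda>t _. scalar1 0)) (\<lambda>_ _ _ _. 1\<^sub>m 1)"
      by (rule family_surjective_trivial[OF mat_range_one])
    moreover have "{0\<^sub>v 1} = {v \<in> carrier_vec 1. col2 1 0 *\<^sub>v v \<in> {0\<^sub>v 2}}"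
      using mat_ker_col2 unfolding mat_ker_def carrier_matD[OF example_mat_carriers(1)] by auto
    ultimately show ?thesis
      unfolding subquotient_def
      using e1 higgs_family_trivial[OF P10 U] mat_ker_one[of 1] 
      by (intro conjI exI[of _ "trivial_family U 1 (\<lambda>t _. scalar1 0)"] exI[of _
          "\<lambda>_ _ _ _. col2 1 0"] exI[of _ "\<lambda>_ _ _ _. 1\<^sub>m 1"])
        (simp_all add: trivial_family_def)
  qed
  have q1: "subquotient L d U ?E (\<lambda>_ _ _. carrier_vec 2) (\<lambda>_ _ _. mat_range (col2 1 0))
      (trivial_family U 1 (\<lambda>t _. scalar1 (y t)))"
  proof -
    have "family_morphism L d U ?E (trivial_family U 1 (\<lambda>t _. scalar1 (y t))) (\<lambda>_ _ _ _. proj2)"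
      by (rule family_morphism_trivial) (auto simp: proj2_higgs2)
    moreover have "family_surjective U ?E (trivial_family U 1 (\<lambda>t _. scalar1 (y t)))
        (\<lambda>_ _ _ _. proj2)"
      by (rule family_surjective_trivial[OF mat_range_proj2])
    moreover have "mat_ker proj2 = {v \<in> carrier_vec 2. 1\<^sub>m 2 *\<^sub>v v \<in> mat_range (col2 1 0)}"
      unfolding mat_ker_proj2 using chain(2) by auto
    ultimately show ?thesis
      unfolding subquotient_def
      using e2 higgs_family_trivial[OF P1 U]
      by (intro conjI exI[of _ ?E] exI[of _ "\<lambda>_ _ _ _. 1\<^sub>m 2"] exI[of _ "\<lambda>_ _ _ _. proj2"])
        (simp_all add: trivial_family_def)
  qed
  show ?thesis
    unfolding relative_harmonic_filtration_def
  proof (intro conjI allI impI)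
    show "higgs_family L d U ?E" by (rule higgs_family_trivial[OF P2 U])
    show "invariant_subbundle L d U ?E (?S i)" for i by (rule inv)
    show "\<forall>c\<in>fcharts ?E. \<forall>u\<in>fudom ?E c. \<forall>z\<in>fxdom ?E c.
        ?S 0 c u z = {0\<^sub>v (frank ?E u)} \<and> ?S 2 c u z = carrier_vec (frank ?E u) \<and>
        (\<forall>i<2. ?S i c u z \<subseteq> ?S (Suc i) c u z)"
      using chain by (auto simp: trivial_family_def less_2_cases_iff)
    have quot0: "\<exists>Q H. subquotient L d U ?E (\<lambda>_ _ _. mat_range (col2 1 0)) (\<lambda>_ _ _. {0\<^sub>v 2}) Q
        \<and> harmonic_metric_family L d U Q H"
      using q0 harmonic_metric_family_one_rank_1[OF P10] by blast
    have quot1: "\<exists>Q H. subquotient L d U ?E (\<lambda>_ _ _. carrier_vec 2)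
        (\<lambda>_ _ _. mat_range (col2 1 0)) Q \<and> harmonic_metric_family L d U Q H"
      using q1 harmonic_metric_family_one_rank_1[OF P1] by blast
    fix i :: nat assume "i < 2"
    then consider "i = 0" | "i = 1" by linarith
    then show "\<exists>Q H. subquotient L d U ?E (?S (Suc i)) (?S i) Q \<and> harmonic_metric_family L d U Q H"
      using quot0 quot1 by cases simp_all
  qed
qed

text \<open>The family is a single extension of two line families with harmonic metrics, so it
  already lies in the prestack over all of \<open>U\<close>.\<close>

lemma in_harmonic_stack_rank_2:
  assumes U: "open U" and p: "\<And>t. x t = poly p (of_real t)" and q: "\<And>t. y t = poly q (of_real t)"
  shows "in_harmonic_stack L d U (trivial_family U 2 (\<lambda>t _. higgs2 (x t) (y t)))"
    (is "in_harmonic_stack L d U ?E")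
proof -
  have P2: "poly_mat 2 2 (\<lambda>t _. higgs2 (x t) (y t))" unfolding p q by (rule poly_mat_higgs2)
  have P1: "poly_mat 1 1 (\<lambda>t _. scalar1 (y t))" unfolding q by (rule poly_mat_scalar1)
  have P10: "poly_mat 1 1 (\<lambda>t _. scalar1 0)" by (intro poly_mat_const example_mat_carriers)
  have E: "higgs_family L d U ?E" by (rule higgs_family_trivial[OF P2 U])
  have "short_exact L d U (trivial_family U 1 (\<lambda>t _. scalar1 0)) ?E (trivial_family U 1
      (\<lambda>t _. scalar1 (y t)))
      (\<lambda>_ _ _ _. col2 1 0) (\<lambda>_ _ _ _. proj2)"
    unfolding short_exact_def
  proof (intro conjI)
    show "family_morphism L d U (trivial_family U 1 (\<lambda>t _. scalar1 0)) ?E (\<lambda>_ _ _ _. col2 1 0)"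
      by (rule family_morphism_trivial) (auto simp: higgs2_col2 col2_scalar1)
    show "family_morphism L d U ?E (trivial_family U 1 (\<lambda>t _. scalar1 (y t))) (\<lambda>_ _ _ _. proj2)"
      by (rule family_morphism_trivial) (auto simp: proj2_higgs2)
  qed (simp_all add: family_injective_trivial mat_ker_col2 family_surjective_trivial
      mat_range_proj2 mat_ker_proj2)
  then have gen: "extension_generated L d U ?E"
    using extension_generated.extension[OF _ _ E]
      extension_generated.harmonic[OF higgs_family_trivial[OF P1 U]
          harmonic_metric_family_one_rank_1[OF P1]]
      extension_generated.harmonic[OF higgs_family_trivial[OF P10 U]
          harmonic_metric_family_one_rank_1[OF P10]]
    by blast
  have iso: "family_iso L d U ?E ?E (\<lambda>_ _ _ _. 1\<^sub>m 2)"
    unfolding family_iso_def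
  proof (intro conjI)
    show "family_morphism L d U ?E ?E (\<lambda>_ _ _ _. 1\<^sub>m 2)"
      by (rule family_morphism_trivial) (simp_all add: right_mult_one_mat[OF
          example_mat_carriers(2)] left_mult_one_mat[OF example_mat_carriers(2)])
  qed (simp_all add: family_injective_trivial mat_ker_one family_surjective_trivial mat_range_one)
  \<comment> \<open>Descent is trivial: the cover has the single member \<open>U\<close> and all
    gluing maps are identities.\<close>
  show ?thesis
    unfolding in_harmonic_stack_def descent_datum_def
    by (intro conjI E exI[of _ "{U}"] exI[of _ "\<lambda>_. ?E"] exI[of _
        "\<lambda>_ _ _ _ _ _. 1\<^sub>m 2"] exI[of _ "\<lambda>_ _ _ _ _. 1\<^sub>m 2"])
      (simp_all add: U gen iso restrict_family_trivial)
qed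

section \<open>The family with entries t and t^2\<close>

theorem proposition14p2:
  fixes L :: "complex set" and a :: "complex \<Rightarrow> complex" and U :: "real set" and E :: family
  assumes "is_lattice L"
    and "a holomorphic_on UNIV" and "periodic_on L UNIV a" and "\<forall>z. a z \<noteq> 0"
    and "open U" and "is_interval U" and "0 \<in> U"
    and "E = trivial_family U 2 (\<lambda>t z. mat_of_rows_list 2
               [[0, of_real t * a z],
                [0, of_real (t\<^sup>2) * a z]])"
  shows "(\<forall>t\<in>U. polystable L (slice t E)) \<and>
     \<not> (\<exists>H. (\<forall>t\<in>U. harmonic_metric L (slice t E) (\<lambda>c. H c t)) \<and> metrics_continuous_at E H 0) \<and>
     (\<exists>l S. relative_harmonic_filtration L \<infinity> U E l S) \<and>
     (\<forall>d. in_harmonic_stack L d U E)"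
proof -
  obtain \<alpha> where \<alpha>: "a = (\<lambda>_. \<alpha>)"
    using lattice_periodic_holomorphic_const assms(1-3) by blast
  with assms(4) have "\<alpha> \<noteq> 0" by simp
  define x y where "x t = complex_of_real t * \<alpha>" and "y t = complex_of_real (t\<^sup>2) * \<alpha>" for t
  have x: "x t = poly [:0, \<alpha>:] (of_real t)" and y: "y t = poly [:0, 0, \<alpha>:] (of_real t)" for t
    by (simp_all add: x_def y_def power2_eq_square)
  have E: "E = trivial_family U 2 (\<lambda>t _. higgs2 (x t) (y t))"
    using assms(8) by (simp add: \<alpha> x_def y_def higgs2_def)
  have "polystable L (slice t E)" if "t \<in> U" for t
  proof -
    \<comment> \<open>For t nonzero the second eigenvector is (1, t), with eigenvalue t^2 \<alpha>.
      At t = 0 the Higgs field vanishes and (0, 1) completes the basis.\<close>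
    define b d where "b = (if t = 0 then 0 else 1 :: complex)" and "d = (if t
        = 0 then 1 else complex_of_real t)"
    have P: "poly_mat 2 2 (\<lambda>t _. higgs2 (x t) (y t))"
      unfolding x y by (rule poly_mat_higgs2)
    have "x t * d = y t * b" "d \<noteq> 0"
      by (auto simp: b_def d_def x_def y_def power2_eq_square)
    then show ?thesis
      unfolding E using polystable_rank_2[OF assms(1) that P refl] by blast
  qed
  moreover have False
    if harm: "\<forall>t\<in>U. harmonic_metric L (slice t E) (\<lambda>c. H c t)" and cont:
        "metrics_continuous_at E H 0" for H
  proof -
    \<comment> \<open>The metric is observed at one point of the curve: \<open>p t\<close> is the
      squared norm of (1, 0), and \<open>q t\<close> is the pairing of (0, 1) with (1, 0).\<close>
    define p q where "p t = H 0 t 0 $$ (0, 0)" and "q t = H 0 t 0 $$ (0, 1)" for t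
    have "p t + of_real t * q t = 0" if "t \<in> U" "t \<noteq> 0" for t
    proof -
      have "p t * x t + q t * y t = 0"
        unfolding p_def q_def
        by (rule harmonic_metric_kernel_orthogonal[OF assms(1) that(1), of
            "\<lambda>t _. higgs2 (x t) (y t)"])
          (use harm that(1) in \<open>simp_all add: E higgs2_def\<close>)
      \<comment> \<open>The image of the Higgs field is spanned by t \<alpha> times (1, t), and this
        factor is nonzero for t nonzero.\<close>
      then have "(of_real t * \<alpha>) * (p t + of_real t * q t) = 0"
        by (simp add: x_def y_def power2_eq_square algebra_simps)
      with \<open>t \<noteq> 0\<close> \<open>\<alpha> \<noteq> 0\<close> show ?thesis by simp
    qed
    then have "\<forall>\<^sub>F t in at 0. p t + of_real t * q t = 0"
      using eventually_at_topological assms(5,7) by blast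
    then have "((\<lambda>t. p t + of_real t * q t) \<longlongrightarrow> 0) (at 0)"
      by (rule tendsto_eventually)
    moreover have "isCont p 0" "isCont q 0"
      using cont assms(7) by (auto simp: metrics_continuous_at_def E trivial_family_def
          p_def[abs_def] q_def[abs_def])
    then have "((\<lambda>t. p t + of_real t * q t) \<longlongrightarrow> p 0 + of_real 0 * q 0) (at 0)"
      by (intro tendsto_intros isContD)
    \<comment> \<open>The term with \<open>q\<close> carries the factor t, so the limit is the
      squared norm of (1, 0) at parameter 0, which positivity forbids to be 0.\<close>
    ultimately have "p 0 = 0"
      using tendsto_unique[OF at_neq_bot] by fastforce
    have "hermitian_metric L (slice 0 E) (\<lambda>c. H c 0)"
      using harm assms(7) unfolding harmonic_metric_def by blast
    then have "pos_def_hermitian 2 (H 0 0 0)"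
      unfolding hermitian_metric_def E slice_trivial_family[OF assms(7)] higgs.simps by blast
    from pos_def_hermitian_2(4)[OF this, of 1 0] \<open>p 0 = 0\<close> show False
      by (simp add: p_def)
  qed
  moreover have "\<exists>l S. relative_harmonic_filtration L \<infinity> U E l S"
    unfolding E using relative_harmonic_filtration_rank_2[OF assms(5) x y] by blast
  moreover have "\<forall>d. in_harmonic_stack L d U E"
    unfolding E using in_harmonic_stack_rank_2[OF assms(5) x y] by blast
  ultimately show ?thesis by blast
qed

end
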